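(* For $n\in\mathbb{N}$ let $\mathrm{tr}_n$ denote the Lie ring of $n\times n$ upper-triangular integer matrices with bracket $[x,y]=xy-yx$. Then for every prime $p$, $$\zeta_{\mathrm{tr}_1(\mathbb{F}_p)}^{\triangleleft}(s)=\zeta_{\mathbb{F}_p}(s)=1+t,$$ $$\zeta_{\mathrm{tr}_2(\mathbb{F}_p)}^{\triangleleft}(s)=\zeta_{\mathbb{F}_p^2}(s)+t^2\zeta_{\mathbb{F}_p}(s)=1+(1+p)t+2t^2+t^3,$$ $$\zeta_{\mathrm{tr}_3(\mathbb{F}_p)}^{\triangleleft}(s)=\zeta_{\mathbb{F}_p^3}(s)+2t^2\zeta_{\mathbb{F}_p^2}(s)+t^4\zeta_{\mathbb{F}_p}(s)+t^5\zeta_{\mathbb{F}_p}(s)$$ $$=1+(1+p+p^2)t+(3+p+p^2)t^2+(3+2p)t^3+3t^4+2t^5+t^6,$$ $$\zeta_{\mathrm{tr}_4(\mathbb{F}_p)}^{\triangleleft}(s)=\zeta_{\mathbb{F}_p^4}(s)+3t^2\zeta_{\mathbb{F}_p^3}(s)+3t^4\zeta_{\mathbb{F}_p^2}(s)+t^6\zeta_{\mathbb{F}_p}(s)+2t^5\left(\zeta_{\mathbb{F}_p^2}(s)+t^2\zeta_{\mathbb{F}_p}(s)\right)+t^8\zeta_{\mathbb{F}_p}(s)+t^9\zeta_{\mathbb{F}_p}(s)$$ $$=1+(1+p+p^2+p^3)t+(4+p+2p^2+p^3+p^4)t^2+(4+4p+4p^2+p^3)t^3+(7+3p+3p^2)t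^4+(8+3p)t^5+(6+2p)t^6+5t^7+3t^8+2t^9+t^{10}.$$
   Context: For a Lie ring $L\cong\mathbb{Z}^m$ (additively) and a prime $p$, $L(\mathbb{F}_p)=L\otimes_{\mathbb{Z}}\mathbb{F}_p$ (so $\mathrm{tr}_n(\mathbb{F}_p)$ is the Lie algebra of upper-triangular $n\times n$ matrices over $\mathbb{F}_p$), and $\zeta_{L(\mathbb{F}_p)}^{\triangleleft}(s)=\sum_{i=0}^{m}a_{p^i}^{\triangleleft}(L(\mathbb{F}_p))\,t^{i}$, where $t=p^{-s}$ and $a_{p^i}^{\triangleleft}(L(\mathbb{F}_p))$ is the number of Lie ideals of $L(\mathbb{F}_p)$ of codimension $i$. Also $\zeta_{\mathbb{F}_p^m}(s)=\sum_{i=0}^m\binom{m}{i}_p t^i$, where $\binom{m}{i}_p$ is the Gaussian binomial coefficient (the number of $i$-dimensional subspaces of $\mathbb{F}_p^m$). *)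

theory Defs
  imports
    "HOL-Analysis.Complex_Transcendental"
    "Jordan_Normal_Form.VS_Connect"
    "Berlekamp_Zassenhaus.Finite_Field"
begin

hide_const (open) Modules.module Polynomial.smult Multiset.mult

section \<open>Lie algebras and Lie ideals\<close>

text \<open>Lie algebras over a commutative ring \<open>R\<close>; a Lie ring is the case of the ring of integers.\<close>

record ('a, 'b) lie_algebra = "('a, 'b) module" +
  lie_bracket :: "'b \<Rightarrow> 'b \<Rightarrow> 'b"

locale lie_algebra = Module.module R L
  for R and L :: "('a, 'b, 'c) lie_algebra_scheme" +
  assumes bracket_closed:
      "\<lbrakk>x \<in> carrier L; y \<in> carrier L\<rbrakk> \<Longrightarrow> lie_bracket L x y \<in> carrier L"
    and bracket_add_left:
      "\<lbrakk>x \<in> carrier L; y \<in> carrier L; z \<in> carrier L\<rbrakk> \<Longrightarrow>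
        lie_bracket L (x \<oplus>\<^bsub>L\<^esub> y) z = lie_bracket L x z \<oplus>\<^bsub>L\<^esub> lie_bracket L y z"
    and bracket_add_right:
      "\<lbrakk>x \<in> carrier L; y \<in> carrier L; z \<in> carrier L\<rbrakk> \<Longrightarrow>
        lie_bracket L x (y \<oplus>\<^bsub>L\<^esub> z) = lie_bracket L x y \<oplus>\<^bsub>L\<^esub> lie_bracket L x z"
    and bracket_smult_left:
      "\<lbrakk>c \<in> carrier R; x \<in> carrier L; y \<in> carrier L\<rbrakk> \<Longrightarrow>
        lie_bracket L (c \<odot>\<^bsub>L\<^esub> x) y = c \<odot>\<^bsub>L\<^esub> lie_bracket L x y"
    and bracket_smult_right:
      "\<lbrakk>c \<in> carrier R; x \<in> carrier L; y \<in> carrier L\<rbrakk> \<Longrightarrow>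
        lie_bracket L x (c \<odot>\<^bsub>L\<^esub> y) = c \<odot>\<^bsub>L\<^esub> lie_bracket L x y"
    and bracket_self: "x \<in> carrier L \<Longrightarrow> lie_bracket L x x = \<zero>\<^bsub>L\<^esub>"
    and jacobi:
      "\<lbrakk>x \<in> carrier L; y \<in> carrier L; z \<in> carrier L\<rbrakk> \<Longrightarrow>
        lie_bracket L x (lie_bracket L y z) \<oplus>\<^bsub>L\<^esub> lie_bracket L y (lie_bracket L z x)
          \<oplus>\<^bsub>L\<^esub> lie_bracket L z (lie_bracket L x y) = \<zero>\<^bsub>L\<^esub>"

text \<open>One-sided closure suffices, as the bracket is antisymmetric.\<close>

definition lie_ideal :: "'a ring \<Rightarrow> 'b set \<Rightarrow> ('a, 'b) lie_algebra \<Rightarrow> bool" where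
  "lie_ideal R I L \<longleftrightarrow>
     submodule R I L \<and> (\<forall>x\<in>carrier L. \<forall>y\<in>I. lie_bracket L x y \<in> I)"


section \<open>Zeta functions over a finite field\<close>

text \<open>Codimension of a subspace \<open>W\<close>; used only in finite-dimensional \<open>V\<close>, where the natural number
  subtraction does not truncate.\<close>

definition codim :: "('a, 'c) ring_scheme \<Rightarrow> 'b set \<Rightarrow> ('a, 'b, 'd) module_scheme \<Rightarrow> nat" where
  "codim K W V = vectorspace.dim K V - vectorspace.dim K (V\<lparr>carrier := W\<rparr>)"

definition num_ideals :: "('k::field, 'b) lie_algebra \<Rightarrow> nat \<Rightarrow> nat" where
  "num_ideals L i = card {I. lie_ideal class_ring I L \<and> codim class_ring I L = i}"

definition ideal_zeta :: "('k::{field,finite}, 'b) lie_algebra \<Rightarrow> complex \<Rightarrow> complex" where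
  "ideal_zeta L s =
     (\<Sum>i\<le>vectorspace.dim class_ring L. of_nat (num_ideals L i) * (of_nat CARD('k) powr (- s)) ^ i)"

text \<open>The Gaussian binomial coefficient, with base the order of the field \<open>'k\<close>, as the number of
  \<open>i\<close>-dimensional subspaces of the space of vectors of length \<open>m\<close>.\<close>

definition gauss_binomial :: "'k::{field,finite} itself \<Rightarrow> nat \<Rightarrow> nat \<Rightarrow> nat" where
  "gauss_binomial ty m i =
     card {W. VectorSpace.subspace class_ring W (module_vec ty m) \<and>
              vectorspace.dim class_ring ((module_vec ty m)\<lparr>carrier := W\<rparr>) = i}"

definition space_zeta :: "'k::{field,finite} itself \<Rightarrow> nat \<Rightarrow> complex \<Rightarrow> complex" where
  "space_zeta ty m s =
     (\<Sum>i\<le>m. of_nat (gauss_binomial ty m i) * (of_nat CARD('k) powr (- s)) ^ i)"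


section \<open>Upper-triangular matrices\<close>

text \<open>Over the integers this is the Lie ring of upper-triangular matrices; over \<open>'p mod_ring\<close>, the
  integers modulo \<open>CARD('p)\<close>, it is the reduction of that Lie ring (see the reduction lemmas below).
  Only the module structure and the bracket are used; \<open>mult\<close> and \<open>one\<close> are there because the record
  type for modules extends that for rings.\<close>

definition tr :: "'a::comm_ring_1 itself \<Rightarrow> nat \<Rightarrow> ('a, 'a mat) lie_algebra" where
  "tr ty n = \<lparr>
    carrier = {A \<in> carrier_mat n n. upper_triangular A},
    mult = (*),
    one = 1\<^sub>m n,
    zero = 0\<^sub>m n n,
    add = (+),
    smult = (\<cdot>\<^sub>m),
    lie_bracket = (\<lambda>x y. x * y - y * x)\<rparr>"

lemma tr_simps [simp]:
  "carrier (tr ty n) = {A \<in> carrier_mat n n. upper_triangular A}"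
  "zero (tr ty n) = 0\<^sub>m n n"
  "add (tr ty n) = (+)"
  "smult (tr ty n) = (\<cdot>\<^sub>m)"
  "lie_bracket (tr ty n) = (\<lambda>x y. x * y - y * x)"
  by (simp_all add: tr_def)

lemma upper_triangular_mult:
  fixes A B :: "'a::comm_ring_1 mat"
  assumes "A \<in> carrier_mat n n" "B \<in> carrier_mat n n" "upper_triangular A" "upper_triangular B"
  shows "upper_triangular (A * B)"
proof
  fix i j assume ij: "j < i" "i < dim_row (A * B)"
  then have "(A * B) $$ (i, j) = (\<Sum>k<n. A $$ (i, k) * B $$ (k, j))"
    using assms(1,2) by (simp add: scalar_prod_def atLeast0LessThan)
  also have "\<dots> = 0"
  proof (rule sum.neutral, rule ballI)
    fix k assume k: "k \<in> {..<n}"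
    show "A $$ (i, k) * B $$ (k, j) = 0"
    proof (cases "k < i")
      case True
      then have "A $$ (i, k) = 0" using ij assms(1,3) by (intro upper_triangularD) auto
      then show ?thesis by simp
    next
      case False
      then have "B $$ (k, j) = 0" using ij k assms(2,4) by (intro upper_triangularD) auto
      then show ?thesis by simp
    qed
  qed
  finally show "(A * B) $$ (i, j) = 0" .
qed

lemma lie_algebra_tr: "lie_algebra class_ring (tr TYPE('a::comm_ring_1) n)"
proof -
  let ?L = "tr TYPE('a) n"
  have grp: "abelian_group ?L"
  proof (rule abelian_groupI)
    fix x assume x: "x \<in> carrier ?L"
    have "- x \<in> carrier ?L" "- x + x = 0\<^sub>m n n"
      using x by (auto simp: upper_triangular_def)
    then show "\<exists>y\<in>carrier ?L. y \<oplus>\<^bsub>?L\<^esub> x = \<zero>\<^bsub>?L\<^esub>"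
      by (intro bexI[of _ "- x"]) simp_all
  qed (auto simp: upper_triangular_def intro: comm_add_mat)
  have closed: "x * y - y * x \<in> carrier ?L" if "x \<in> carrier ?L" "y \<in> carrier ?L" for x y
  proof -
    have "upper_triangular (x * y)" "upper_triangular (y * x)"
      using that by (auto intro: upper_triangular_mult)
    then show ?thesis using that by (auto simp: upper_triangular_def)
  qed
  have "Module.module (class_ring :: 'a ring) ?L"
  proof (rule moduleI[OF class_cring.is_cring grp])
    fix a b :: 'a and x y :: "'a mat"
    assume x: "x \<in> carrier ?L" and y: "y \<in> carrier ?L"
    show "a \<odot>\<^bsub>?L\<^esub> x \<in> carrier ?L" using x by (auto simp: upper_triangular_def)
    show "(a \<oplus>\<^bsub>class_ring\<^esub> b) \<odot>\<^bsub>?L\<^esub> x = a \<odot>\<^bsub>?L\<^esub> x \<oplus>\<^bsub>?L\<^esub> b \<odot>\<^bsub>?L\<^esub> x"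
      using x by (simp add: add_smult_distrib_right_mat[of _ n n])
    show "a \<odot>\<^bsub>?L\<^esub> (x \<oplus>\<^bsub>?L\<^esub> y) = a \<odot>\<^bsub>?L\<^esub> x \<oplus>\<^bsub>?L\<^esub> a \<odot>\<^bsub>?L\<^esub> y"
      using x y by (simp add: add_smult_distrib_left_mat[of _ n n])
    show "(a \<otimes>\<^bsub>class_ring\<^esub> b) \<odot>\<^bsub>?L\<^esub> x = a \<odot>\<^bsub>?L\<^esub> (b \<odot>\<^bsub>?L\<^esub> x)"
      by (simp, rule eq_matI) (auto simp: mult.assoc)
    show "\<one>\<^bsub>class_ring\<^esub> \<odot>\<^bsub>?L\<^esub> x = x" by (simp, rule eq_matI) auto
  qed
  then show ?thesis
  proof (intro lie_algebra.intro lie_algebra_axioms.intro)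
    fix x y z :: "'a mat" assume "x \<in> carrier ?L" "y \<in> carrier ?L" "z \<in> carrier ?L"
    then have x: "x \<in> carrier_mat n n" and y: "y \<in> carrier_mat n n" and z: "z \<in> carrier_mat n n"
      by auto
    have 1: "(x + y) * z = x * z + y * z" "z * (x + y) = z * x + z * y"
      "x * (y + z) = x * y + x * z" "(y + z) * x = y * x + z * x"
      using x y z by (auto intro: add_mult_distrib_mat mult_add_distrib_mat)
    show "lie_bracket ?L (x \<oplus>\<^bsub>?L\<^esub> y) z = lie_bracket ?L x z \<oplus>\<^bsub>?L\<^esub> lie_bracket ?L y z"
      using x y z by (simp add: 1) (rule eq_matI, auto)
    show "lie_bracket ?L x (y \<oplus>\<^bsub>?L\<^esub> z) = lie_bracket ?L x y \<oplus>\<^bsub>?L\<^esub> lie_bracket ?L x z"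
      using x y z by (simp add: 1) (rule eq_matI, auto)
    have 2: "a * (b * c - c * b) - (b * c - c * b) * a =
        (a * (b * c) - a * (c * b)) - (b * (c * a) - c * (b * a))"
      if a: "a \<in> carrier_mat n n" and b: "b \<in> carrier_mat n n" and c: "c \<in> carrier_mat n n"
      for a b c :: "'a mat"
    proof -
      have "a * (b * c - c * b) = a * (b * c) - a * (c * b)"
        by (rule mult_minus_distrib_mat[OF a mult_carrier_mat[OF b c] mult_carrier_mat[OF c b]])
      moreover have "(b * c - c * b) * a = b * c * a - c * b * a"
        by (rule minus_mult_distrib_mat[OF mult_carrier_mat[OF b c] mult_carrier_mat[OF c b] a])
      ultimately show ?thesis
        by (simp only: assoc_mult_mat[OF b c a] assoc_mult_mat[OF c b a])
    qed
    have 3: "((A - B) - (C - D)) + ((C - E) - (F - B)) + ((F - D) - (A - E)) = 0\<^sub>m n n"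
      if "A \<in> carrier_mat n n" "B \<in> carrier_mat n n" "C \<in> carrier_mat n n"
        "D \<in> carrier_mat n n" "E \<in> carrier_mat n n" "F \<in> carrier_mat n n"
      for A B C D E F :: "'a mat"
      using that by (intro eq_matI) auto
    show "lie_bracket ?L x (lie_bracket ?L y z) \<oplus>\<^bsub>?L\<^esub> lie_bracket ?L y (lie_bracket ?L z x)
        \<oplus>\<^bsub>?L\<^esub> lie_bracket ?L z (lie_bracket ?L x y) = \<zero>\<^bsub>?L\<^esub>"
      unfolding tr_simps 2[OF x y z] 2[OF y z x] 2[OF z x y]
      by (rule 3) (intro mult_carrier_mat[of _ n n] x y z)+
  next
    fix c and x y :: "'a mat" assume "x \<in> carrier ?L" "y \<in> carrier ?L"
    then have x: "x \<in> carrier_mat n n" and y: "y \<in> carrier_mat n n" by auto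
    have 1: "(c \<cdot>\<^sub>m x) * y = c \<cdot>\<^sub>m (x * y)" "y * (c \<cdot>\<^sub>m x) = c \<cdot>\<^sub>m (y * x)"
      "x * (c \<cdot>\<^sub>m y) = c \<cdot>\<^sub>m (x * y)" "(c \<cdot>\<^sub>m y) * x = c \<cdot>\<^sub>m (y * x)"
      using x y by (auto simp: mult_smult_distrib[of _ n n] mult_smult_assoc_mat[of _ n n])
    show "lie_bracket ?L (c \<odot>\<^bsub>?L\<^esub> x) y = c \<odot>\<^bsub>?L\<^esub> lie_bracket ?L x y"
      using x y by (simp add: 1) (rule eq_matI, auto simp: algebra_simps)
    show "lie_bracket ?L x (c \<odot>\<^bsub>?L\<^esub> y) = c \<odot>\<^bsub>?L\<^esub> lie_bracket ?L x y"
      using x y by (simp add: 1) (rule eq_matI, auto simp: algebra_simps)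
  qed (use closed in auto)
qed

text \<open>Reduction modulo \<open>p = CARD('p)\<close> is a surjective morphism of the Lie ring \<open>tr TYPE(int) n\<close> onto
  \<open>tr TYPE('p mod_ring) n\<close> whose kernel consists of the multiples of \<open>p\<close>, so the latter is the
  tensor product of the former with the prime field.\<close>

abbreviation red :: "int mat \<Rightarrow> 'p::prime_card mod_ring mat" where
  "red \<equiv> map_mat of_int"

lemma of_int_mod_ring_eq_0_iff:
  "(of_int k :: 'p::prime_card mod_ring) = 0 \<longleftrightarrow> int CARD('p) dvd k"
  unfolding of_int_of_int_mod_ring by transfer (simp add: dvd_eq_mod_eq_0)

lemma tr_reduction_surj:
  "red ` carrier (tr TYPE(int) n) = carrier (tr TYPE('p::prime_card mod_ring) n)"
proof (rule subset_antisym)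
  show "red ` carrier (tr TYPE(int) n) \<subseteq> carrier (tr TYPE('p mod_ring) n)"
    by (auto simp: upper_triangular_def)
  show "carrier (tr TYPE('p mod_ring) n) \<subseteq> red ` carrier (tr TYPE(int) n)"
  proof
    fix A :: "'p mod_ring mat" assume A: "A \<in> carrier (tr TYPE('p mod_ring) n)"
    have z: "to_int_mod_ring (0 :: 'p mod_ring) = 0" by (rule to_int_mod_ring_hom.hom_zero)
    have "A = red (map_mat to_int_mod_ring A)"
      by (rule eq_matI) (simp_all add: of_int_of_int_mod_ring)
    moreover have "map_mat to_int_mod_ring A \<in> carrier (tr TYPE(int) n)"
      using A by (auto simp: upper_triangular_def z)
    ultimately show "A \<in> red ` carrier (tr TYPE(int) n)" by blast
  qed
qed

lemma tr_reduction_hom: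
  assumes "x \<in> carrier (tr TYPE(int) n)" and "y \<in> carrier (tr TYPE(int) n)"
  shows "red (x \<oplus>\<^bsub>tr TYPE(int) n\<^esub> y) =
      (red x \<oplus>\<^bsub>tr TYPE('p mod_ring) n\<^esub> red y :: 'p::prime_card mod_ring mat)"
    and "red (lie_bracket (tr TYPE(int) n) x y) =
      (lie_bracket (tr TYPE('p mod_ring) n) (red x) (red y) :: 'p::prime_card mod_ring mat)"
proof -
  have x: "x \<in> carrier_mat n n" and y: "y \<in> carrier_mat n n" using assms by auto
  show "red (x \<oplus>\<^bsub>tr TYPE(int) n\<^esub> y) =
      (red x \<oplus>\<^bsub>tr TYPE('p mod_ring) n\<^esub> red y :: 'p mod_ring mat)"
    using x y by (simp, intro eq_matI) auto
  have m: "red (x * y) = (red x * red y :: 'p mod_ring mat)"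
    "red (y * x) = (red y * red x :: 'p mod_ring mat)"
    by (rule of_int_hom.mat_hom_mult[OF x y] of_int_hom.mat_hom_mult[OF y x])+
  have "red (a - b) = (red a - red b :: 'p mod_ring mat)"
    if "a \<in> carrier_mat n n" "b \<in> carrier_mat n n" for a b
    using that by (intro eq_matI) auto
  from this[OF mult_carrier_mat[OF x y] mult_carrier_mat[OF y x]]
  show "red (lie_bracket (tr TYPE(int) n) x y) =
      (lie_bracket (tr TYPE('p mod_ring) n) (red x) (red y) :: 'p mod_ring mat)"
    by (simp only: tr_simps m)
qed

lemma tr_reduction_kernel:
  "{x \<in> carrier (tr TYPE(int) n). red x = (0\<^sub>m n n :: 'p::prime_card mod_ring mat)} =
     (\<lambda>x. int CARD('p) \<odot>\<^bsub>tr TYPE(int) n\<^esub> x) ` carrier (tr TYPE(int) n)"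
proof (intro subset_antisym subsetI)
  fix x assume x: "x \<in> {x \<in> carrier (tr TYPE(int) n). red x = (0\<^sub>m n n :: 'p mod_ring mat)}"
  then have xc: "x \<in> carrier_mat n n" and x0: "red x = (0\<^sub>m n n :: 'p mod_ring mat)" by auto
  have dvd: "int CARD('p) dvd x $$ (i, j)" if "i < n" "j < n" for i j
  proof -
    have "(red x :: 'p mod_ring mat) $$ (i, j) = 0" unfolding x0 using that by simp
    then have "(of_int (x $$ (i, j)) :: 'p mod_ring) = 0" using xc that by simp
    then show ?thesis by (simp only: of_int_mod_ring_eq_0_iff)
  qed
  let ?y = "map_mat (\<lambda>a. a div int CARD('p)) x"
  have "x = int CARD('p) \<cdot>\<^sub>m ?y" using xc dvd by (intro eq_matI) auto
  moreover have "?y \<in> carrier (tr TYPE(int) n)" using x by (auto simp: upper_triangular_def)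
  ultimately show "x \<in> (\<lambda>x. int CARD('p) \<odot>\<^bsub>tr TYPE(int) n\<^esub> x) ` carrier (tr TYPE(int) n)"
    unfolding tr_simps(4) by blast
next
  fix x assume "x \<in> (\<lambda>x. int CARD('p) \<odot>\<^bsub>tr TYPE(int) n\<^esub> x) ` carrier (tr TYPE(int) n)"
  then obtain y where y: "y \<in> carrier_mat n n" "upper_triangular y" and xy: "x = int CARD('p) \<cdot>\<^sub>m y"
    by auto
  have "(red x :: 'p mod_ring mat) = 0\<^sub>m n n"
  proof (rule eq_matI)
    fix i j assume ij: "i < dim_row (0\<^sub>m n n :: 'p mod_ring mat)"
      "j < dim_col (0\<^sub>m n n :: 'p mod_ring mat)"
    then have "(red x :: 'p mod_ring mat) $$ (i, j) = of_int (int CARD('p) * y $$ (i, j))"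
      unfolding xy using y(1) by (simp del: of_int_mult)
    also have "\<dots> = 0" unfolding of_int_mod_ring_eq_0_iff by simp
    finally show "(red x :: 'p mod_ring mat) $$ (i, j) = (0\<^sub>m n n :: 'p mod_ring mat) $$ (i, j)"
      using ij by simp
  qed (use xy y(1) in auto)
  moreover have "x \<in> carrier (tr TYPE(int) n)"
    unfolding xy using y by (auto simp: upper_triangular_def)
  ultimately show "x \<in> {x \<in> carrier (tr TYPE(int) n). red x = (0\<^sub>m n n :: 'p mod_ring mat)}"
    by simp
qed

end

theory Submission
  imports Defs
begin

text \<open>The diagonal matrices act on \<open>tr n\<close> with one-dimensional root spaces spanned by the
  matrix units \<open>E i j\<close>, \<open>i < j\<close>, belonging to pairwise distinct nonzero weights \<open>d i - d j\<close> (even in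
  characteristic 2). An ideal is therefore the sum of the root spaces in a set \<open>S\<close> of positive roots
  and of a space \<open>D\<close> of diagonal matrices. The ideal condition says exactly that \<open>S\<close> is an upper set
  in the root poset and that every root outside \<open>S\<close> vanishes on \<open>D\<close>. If \<open>r\<close> simple roots are missing
  from \<open>S\<close>, then \<open>D\<close> ranges over all subspaces of a space of dimension \<open>n - r\<close>, so that \<open>S\<close>
  contributes \<open>t\<close> to the power \<open>r\<close> plus the number of roots outside \<open>S\<close>, times the zeta function of
  an \<open>(n - r)\<close>-dimensional space. For \<open>n \<le> 4\<close> there are 1, 2, 5 and 14 upper sets.\<close>

section \<open>Subspaces of a finite vector space\<close>

lemma (in vectorspace) submodule_minus:
  assumes W: "submodule K W V" and "x \<in> W" "y \<in> W"
  shows "x \<ominus>\<^bsub>V\<^esub> y \<in> W"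
proof -
  interpret W: submodule K W V by fact
  have "y \<in> carrier V" using assms W.subset by blast
  then have "\<ominus>\<^bsub>V\<^esub> y = (\<ominus>\<^bsub>K\<^esub> \<one>\<^bsub>K\<^esub>) \<odot>\<^bsub>V\<^esub> y" by (simp add: smult_l_minus)
  then have "\<ominus>\<^bsub>V\<^esub> y \<in> W" using assms W.smult_closed by simp
  then show ?thesis using assms W.m_closed unfolding a_minus_def by simp
qed

lemma (in vectorspace) submodule_Int:
  assumes "submodule K W V" "submodule K W' V"
  shows "submodule K (W \<inter> W') V"
proof -
  interpret W: submodule K W V by fact
  interpret W': submodule K W' V by fact
  show ?thesis using W.subset by unfold_locales auto
qed

lemma (in vectorspace) submodule_carrier: "submodule K (carrier V) V"
  by unfold_locales auto

lemma (in vectorspace) submodule_zero: "submodule K {\<zero>\<^bsub>V\<^esub>} V"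
  by unfold_locales auto

lemma (in vectorspace) submodule_smult_cancel:
  assumes W: "submodule K W V" and w: "w \<in> carrier V"
    and c: "c \<in> carrier K" "c \<noteq> \<zero>\<^bsub>K\<^esub>" and cw: "c \<odot>\<^bsub>V\<^esub> w \<in> W"
  shows "w \<in> W"
proof -
  interpret W: submodule K W V by fact
  have u: "c \<in> Units K" using c by (simp add: field_Units)
  have "inv\<^bsub>K\<^esub> c \<odot>\<^bsub>V\<^esub> (c \<odot>\<^bsub>V\<^esub> w) \<in> W" by (rule W.smult_closed[OF Units_inv_closed[OF u] cw])
  also have "inv\<^bsub>K\<^esub> c \<odot>\<^bsub>V\<^esub> (c \<odot>\<^bsub>V\<^esub> w) = w"
    using u c w by (simp flip: smult_assoc1)
  finally show ?thesis .
qed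

section \<open>Adjoining one vector to a subspace\<close>

text \<open>The span of \<open>W\<close> and \<open>w\<close>, given by its parametrisation over
  \<open>W \<times> carrier K\<close>, so that its size follows from injectivity of that
  map.\<close>

definition (in vectorspace) adjoin :: "'c set \<Rightarrow> 'c \<Rightarrow> 'c set" where
  "adjoin W w = (\<lambda>(x, c). x \<oplus>\<^bsub>V\<^esub> c \<odot>\<^bsub>V\<^esub> w) ` (W \<times> carrier K)"

context vectorspace
begin

context
  fixes W w
  assumes W: "submodule K W V" and w: "w \<in> carrier V"
begin

interpretation W: submodule K W V by (rule W)

lemma submodule_adjoin: "submodule K (adjoin W w) V"
proof (unfold_locales)
  have sub: "x \<in> W \<Longrightarrow> x \<in> carrier V" for x using W.subset by blast
  show "adjoin W w \<subseteq> carrier V" using sub w by (auto simp: adjoin_def)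
  have "\<zero>\<^bsub>V\<^esub> = \<zero>\<^bsub>V\<^esub> \<oplus>\<^bsub>V\<^esub> \<zero>\<^bsub>K\<^esub> \<odot>\<^bsub>V\<^esub> w" using w by simp
  then show "\<zero>\<^bsub>V\<^esub> \<in> adjoin W w" unfolding adjoin_def by (force intro: W.zero_closed)
  fix u v assume "u \<in> adjoin W w" "v \<in> adjoin W w"
  then obtain x c y d where
    x: "x \<in> W" "c \<in> carrier K" "u = x \<oplus>\<^bsub>V\<^esub> c \<odot>\<^bsub>V\<^esub> w" and
    y: "y \<in> W" "d \<in> carrier K" "v = y \<oplus>\<^bsub>V\<^esub> d \<odot>\<^bsub>V\<^esub> w"
    by (auto simp: adjoin_def)
  have "u \<oplus>\<^bsub>V\<^esub> v = (x \<oplus>\<^bsub>V\<^esub> y) \<oplus>\<^bsub>V\<^esub> (c \<oplus>\<^bsub>K\<^esub> d) \<odot>\<^bsub>V\<^esub> w"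
    using x y w sub by (simp add: smult_l_distr M.add.m_ac)
  moreover have "x \<oplus>\<^bsub>V\<^esub> y \<in> W" "c \<oplus>\<^bsub>K\<^esub> d \<in> carrier K" using x y by auto
  ultimately show "u \<oplus>\<^bsub>V\<^esub> v \<in> adjoin W w" unfolding adjoin_def by force
next
  have sub: "x \<in> W \<Longrightarrow> x \<in> carrier V" for x using W.subset by blast
  fix a u assume a: "a \<in> carrier K" and "u \<in> adjoin W w"
  then obtain x c where x: "x \<in> W" "c \<in> carrier K" "u = x \<oplus>\<^bsub>V\<^esub> c \<odot>\<^bsub>V\<^esub> w"
    by (auto simp: adjoin_def)
  have "a \<odot>\<^bsub>V\<^esub> u = a \<odot>\<^bsub>V\<^esub> x \<oplus>\<^bsub>V\<^esub> (a \<otimes>\<^bsub>K\<^esub> c) \<odot>\<^bsub>V\<^esub> w"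
    using x a w sub by (simp add: smult_r_distr smult_assoc1)
  moreover have "a \<odot>\<^bsub>V\<^esub> x \<in> W" "a \<otimes>\<^bsub>K\<^esub> c \<in> carrier K" using x a by auto
  ultimately show "a \<odot>\<^bsub>V\<^esub> u \<in> adjoin W w" unfolding adjoin_def by force
qed

lemma subset_adjoin: "W \<subseteq> adjoin W w"
proof
  fix x assume "x \<in> W"
  moreover from this have "x = x \<oplus>\<^bsub>V\<^esub> \<zero>\<^bsub>K\<^esub> \<odot>\<^bsub>V\<^esub> w" using w W.subset by auto
  ultimately show "x \<in> adjoin W w" unfolding adjoin_def by force
qed

lemma mem_adjoin: "w \<in> adjoin W w"
proof -
  have "w = \<zero>\<^bsub>V\<^esub> \<oplus>\<^bsub>V\<^esub> \<one>\<^bsub>K\<^esub> \<odot>\<^bsub>V\<^esub> w" using w by auto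
  then show ?thesis unfolding adjoin_def by (force intro: W.zero_closed)
qed

lemma adjoin_subset:
  assumes U: "submodule K U V" and "W \<subseteq> U" "w \<in> U"
  shows "adjoin W w \<subseteq> U"
proof -
  interpret U: submodule K U V by fact
  show ?thesis using assms by (auto simp: adjoin_def)
qed

text \<open>Two representations of one vector yield a multiple \<open>c - d\<close> of
  \<open>w\<close> lying in \<open>W\<close>; as \<open>w\<close> is outside \<open>W\<close>, this
  scalar is zero, so the parametrisation is injective.\<close>

lemma card_adjoin:
  assumes "w \<notin> W"
  shows "card (adjoin W w) = card (carrier K) * card W"
proof -
  have sub: "x \<in> W \<Longrightarrow> x \<in> carrier V" for x using W.subset by blast
  have "inj_on (\<lambda>(x, c). x \<oplus>\<^bsub>V\<^esub> c \<odot>\<^bsub>V\<^esub> w) (W \<times> carrier K)"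
  proof (rule inj_onI, clarify)
    fix x c y d
    assume x: "x \<in> W" "c \<in> carrier K" and y: "y \<in> W" "d \<in> carrier K"
      and eq: "x \<oplus>\<^bsub>V\<^esub> c \<odot>\<^bsub>V\<^esub> w = y \<oplus>\<^bsub>V\<^esub> d \<odot>\<^bsub>V\<^esub> w"
    have cl: "x \<in> carrier V" "y \<in> carrier V" "c \<odot>\<^bsub>V\<^esub> w \<in> carrier V" "d \<odot>\<^bsub>V\<^esub> w \<in> carrier V"
      using x y sub w by auto
    have "(c \<ominus>\<^bsub>K\<^esub> d) \<odot>\<^bsub>V\<^esub> w = c \<odot>\<^bsub>V\<^esub> w \<ominus>\<^bsub>V\<^esub> d \<odot>\<^bsub>V\<^esub> w"
      using x y w by (simp add: a_minus_def smult_l_distr smult_l_minus)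
    also have "\<dots> = y \<ominus>\<^bsub>V\<^esub> x"
    proof -
      have "c \<odot>\<^bsub>V\<^esub> w = \<ominus>\<^bsub>V\<^esub> x \<oplus>\<^bsub>V\<^esub> (y \<oplus>\<^bsub>V\<^esub> d \<odot>\<^bsub>V\<^esub> w)"
        using cl by (simp add: M.r_neg1 flip: eq)
      then show ?thesis
        using cl by (simp add: a_minus_def M.add.m_ac M.r_neg M.r_neg2)
    qed
    also have "\<dots> \<in> W" by (rule submodule_minus[OF W y(1) x(1)])
    finally have "(c \<ominus>\<^bsub>K\<^esub> d) \<odot>\<^bsub>V\<^esub> w \<in> W" .
    then have "c \<ominus>\<^bsub>K\<^esub> d = \<zero>\<^bsub>K\<^esub>"
      using submodule_smult_cancel[OF W w] assms x y by (metis R.minus_closed)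
    then have "c = d" using x y by simp
    then show "x = y \<and> c = d" using eq cl by simp
  qed
  then show ?thesis
    unfolding adjoin_def by (simp add: card_image card_cartesian_product)
qed

end

end

section \<open>Counting subspaces of a given dimension\<close>

text \<open>The Gaussian binomial coefficients by the q-Pascal rule, in the form that counting along
  a hyperplane produces. For \<open>k > m\<close> the truncated exponent \<open>m - k\<close> is
  harmless, because it only multiplies zero.\<close>

fun gauss_poly :: "nat \<Rightarrow> nat \<Rightarrow> nat \<Rightarrow> nat" where
  "gauss_poly q m 0 = 1"
| "gauss_poly q 0 (Suc k) = 0"
| "gauss_poly q (Suc m) (Suc k) = gauss_poly q m (Suc k) + q ^ (m - k) * gauss_poly q m k"

locale finite_vectorspace = vectorspace +
  assumes finite_scalars: "finite (carrier K)" and finite_vectors: "finite (carrier V)"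
begin

abbreviation q :: nat where "q \<equiv> card (carrier K)"

lemma q_ge_2: "q \<ge> 2"
proof -
  have "card {\<zero>\<^bsub>K\<^esub>, \<one>\<^bsub>K\<^esub>} \<le> q" by (intro card_mono finite_scalars) auto
  then show ?thesis by simp
qed

lemma q_gt_1: "q > 1"
  using q_ge_2 by simp

lemma finite_submodule: "submodule K W V \<Longrightarrow> finite W"
  by (rule finite_subset[OF submodule.subset finite_vectors])

lemma finite_submodules: "finite {W. submodule K W V \<and> P W}"
proof (rule finite_subset)
  show "{W. submodule K W V \<and> P W} \<subseteq> Pow (carrier V)"
    using submodule.subset by blast
  show "finite (Pow (carrier V))" using finite_vectors by simp
qed

lemma finite_vectorspace_submodule:
  assumes "submodule K W V"
  shows "finite_vectorspace K (vs W)"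
proof -
  have "subspace K W V" by (intro subspace.intro vectorspace_axioms assms)
  then interpret W: vectorspace K "vs W" by (rule subspace_is_vs)
  show ?thesis by unfold_locales (simp_all add: finite_scalars finite_submodule assms)
qed

text \<open>A basis identifies vectors with coefficient functions on it. Cardinalities can thus
  replace dimensions in all later counts, the base \<open>q > 1\<close> making the exponent
  unique.\<close>

lemma card_carrier: "card (carrier V) = q ^ dim"
proof -
  have "carrier V \<subseteq> span (carrier V)" by (rule in_own_span) simp
  then have "gen_set (carrier V)" using span_is_subset2[of "carrier V"] by auto
  then have "fin_dim" unfolding fin_dim_def using finite_vectors by blast
  then obtain B where B: "finite B" "basis B" using finite_basis_exists by blast
  then have BV: "B \<subseteq> carrier V" by (simp add: basis_def)
  have u: "\<exists>!a. a \<in> B \<rightarrow>\<^sub>E carrier K \<and> lincomb a B = v" if "v \<in> carrier V" for v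
    using basis_criterion[OF B(1) BV] B(2) that by blast
  have cl: "lincomb a B \<in> carrier V" if "a \<in> B \<rightarrow>\<^sub>E carrier K" for a
    using that BV by (intro lincomb_closed) auto
  have "bij_betw (\<lambda>a. lincomb a B) (B \<rightarrow>\<^sub>E carrier K) (carrier V)"
    unfolding bij_betw_def
  proof
    show "inj_on (\<lambda>a. lincomb a B) (B \<rightarrow>\<^sub>E carrier K)"
    proof (rule inj_onI)
      fix a b assume "a \<in> B \<rightarrow>\<^sub>E carrier K" "b \<in> B \<rightarrow>\<^sub>E carrier K" "lincomb a B = lincomb b B"
      then show "a = b" using u[OF cl[of b]] by blast
    qed
    show "(\<lambda>a. lincomb a B) ` (B \<rightarrow>\<^sub>E carrier K) = carrier V"
      using u cl by blast
  qed
  then have "card (carrier V) = card (B \<rightarrow>\<^sub>E carrier K)" by (simp add: bij_betw_same_card)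
  also have "\<dots> = q ^ card B" using B(1) by (simp add: card_PiE)
  finally show ?thesis using dim_basis[OF B] by simp
qed

lemma card_submodule:
  assumes "submodule K W V"
  shows "card W = q ^ vectorspace.dim K (vs W)"
proof -
  interpret W: finite_vectorspace K "vs W" by (rule finite_vectorspace_submodule[OF assms])
  show ?thesis using W.card_carrier by simp
qed

lemma dim_submodule_eq_iff:
  assumes "submodule K W V"
  shows "vectorspace.dim K (vs W) = k \<longleftrightarrow> card W = q ^ k"
  using card_submodule[OF assms] power_inject_exp[OF q_gt_1] by simp

lemma submodule_card_1:
  assumes "submodule K W V" "card W = 1"
  shows "W = {\<zero>\<^bsub>V\<^esub>}"
proof -
  interpret W: submodule K W V by fact
  obtain x where "W = {x}" using assms(2) by (rule card_1_singletonE)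
  then show ?thesis using W.zero_closed by simp
qed

lemma submodules_card_1:
  assumes "submodule K U V"
  shows "{W. submodule K W V \<and> W \<subseteq> U \<and> card W = 1} = {{\<zero>\<^bsub>V\<^esub>}}"
proof -
  interpret U: submodule K U V by fact
  show ?thesis
  proof (intro subset_antisym subsetI)
    fix W assume "W \<in> {{\<zero>\<^bsub>V\<^esub>}}"
    then show "W \<in> {W. submodule K W V \<and> W \<subseteq> U \<and> card W = 1}"
      using submodule_zero U.zero_closed by simp
  qed (simp add: submodule_card_1)
qed

text \<open>Finiteness gives a maximal proper subspace \<open>H\<close> of \<open>U\<close>;
  adjoining a vector of \<open>U - H\<close> enlarges it, hence yields all of
  \<open>U\<close>.\<close>

lemma hyperplane_exists:
  assumes U: "submodule K U V" and "U \<noteq> {\<zero>\<^bsub>V\<^esub>}"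
  obtains H where "submodule K H V" "H \<subset> U" "\<And>w. w \<in> U - H \<Longrightarrow> adjoin H w = U"
proof -
  interpret U: submodule K U V by fact
  let ?P = "{H. submodule K H V \<and> H \<subset> U}"
  have "finite ?P" by (rule finite_submodules)
  moreover have "{\<zero>\<^bsub>V\<^esub>} \<in> ?P" using assms U.zero_closed submodule_zero by auto
  ultimately obtain H where H: "H \<in> ?P" and max: "\<forall>W\<in>?P. H \<subseteq> W \<longrightarrow> H = W"
    using finite_has_maximal[of ?P] by (metis (no_types, lifting) empty_iff)
  have HV: "submodule K H V" and HU: "H \<subset> U" using H by simp_all
  have "adjoin H w = U" if w: "w \<in> U - H" for w
  proof (rule ccontr)
    have wV: "w \<in> carrier V" using w U.subset by blast
    assume "adjoin H w \<noteq> U"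
    moreover have "adjoin H w \<subseteq> U" using HU w by (intro adjoin_subset[OF HV wV U]) auto
    ultimately have "adjoin H w \<in> ?P" using submodule_adjoin[OF HV wV] by simp
    then have "H = adjoin H w" using subset_adjoin[OF HV wV] max by blast
    then show False using mem_adjoin[OF HV wV] w by blast
  qed
  then show thesis using that HV HU by blast
qed

text \<open>The subspaces \<open>W\<close> not contained in a hyperplane \<open>H\<close> and meeting it in \<open>T\<close> partition
  \<open>U - H\<close> into the sets \<open>W - T\<close>.\<close>

lemma card_submodules_over:
  assumes H: "submodule K H V" "H \<subseteq> U" and U: "submodule K U V"
    and cH: "card H = q ^ m" and cU: "card U = q ^ Suc m"
    and T: "submodule K T V" "T \<subseteq> H" and cT: "card T = q ^ k"
  shows "card {W. submodule K W V \<and> W \<subseteq> U \<and> card W = q ^ Suc k \<and> W \<inter> H = T} = q ^ (m - k)"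
proof -
  let ?F = "{W. submodule K W V \<and> W \<subseteq> U \<and> card W = q ^ Suc k \<and> W \<inter> H = T}"
  interpret U: submodule K U V by fact
  interpret T: submodule K T V by fact
  have fin: "finite U" "finite H" "finite T" using finite_submodule H U T by auto
  have qk: "q ^ k > 0" "q ^ m > 0" using q_ge_2 by auto
  have km: "k \<le> m"
    using card_mono[OF fin(2) T(2)] cT cH power_le_imp_le_exp[OF q_gt_1] by simp
  have cWT: "card (W - T) = q ^ Suc k - q ^ k" if "W \<in> ?F" for W
    using that cT fin by (subst card_Diff_subset) auto
  \<comment> \<open>\<open>T\<close> together with any vector of \<open>W - T\<close> already has as
    many elements as \<open>W\<close>. So a single vector outside \<open>T\<close> determines
    \<open>W\<close>, which makes the sets \<open>W - T\<close> disjoint.\<close>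
  have adj: "W = adjoin T w" if W: "W \<in> ?F" and w: "w \<in> W - T" for W w
  proof -
    have wV: "w \<in> carrier V" using W w U.subset by blast
    have "card (adjoin T w) = q ^ Suc k" using card_adjoin[OF T(1) wV] w cT by simp
    moreover have "adjoin T w \<subseteq> W" using W w by (intro adjoin_subset[OF T(1) wV]) auto
    ultimately show ?thesis
      using W finite_submodule card_subset_eq[of W "adjoin T w"] by auto
  qed
  have "(\<Union>W\<in>?F. W - T) = U - H"
  proof (intro subset_antisym subsetI)
    fix w assume w: "w \<in> U - H"
    then have wV: "w \<in> carrier V" and wT: "w \<notin> T" using U.subset T(2) by blast+
    let ?W = "adjoin T w"
    have W: "submodule K ?W V" "T \<subseteq> ?W" "w \<in> ?W" "?W \<subseteq> U"
      using submodule_adjoin[OF T(1) wV] subset_adjoin[OF T(1) wV] mem_adjoin[OF T(1) wV]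
        adjoin_subset[OF T(1) wV U] T(2) w H(2) by auto
    have cW: "card ?W = q ^ Suc k" using card_adjoin[OF T(1) wV wT] cT by simp
    \<comment> \<open>A vector of the intersection outside \<open>T\<close> would, by counting,
      generate all of \<open>?W\<close> over \<open>T\<close> and force \<open>w\<close> into
      \<open>H\<close>.\<close>
    have "?W \<inter> H = T"
    proof
      show "?W \<inter> H \<subseteq> T"
      proof
        fix x assume x: "x \<in> ?W \<inter> H"
        show "x \<in> T"
        proof (rule ccontr)
          assume xT: "x \<notin> T"
          have xV: "x \<in> carrier V" using x W U.subset by blast
          have "adjoin T x \<subseteq> ?W \<inter> H"
            using x W T by (intro adjoin_subset[OF T(1) xV] submodule_Int H) auto
          moreover have "card (adjoin T x) = card ?W"
            using card_adjoin[OF T(1) xV xT] cT cW by simp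
          moreover have "finite ?W" using W finite_submodule by blast
          ultimately have "adjoin T x = ?W" by (intro card_subset_eq) auto
          then show False using \<open>adjoin T x \<subseteq> ?W \<inter> H\<close> W w by auto
        qed
      qed
    qed (use W T in auto)
    then have "?W \<in> ?F" using W cW by auto
    then show "w \<in> (\<Union>W\<in>?F. W - T)" using W wT by blast
  qed (use T in blast)
  then have "card (U - H) = card (\<Union>W\<in>?F. W - T)" by simp
  also have "\<dots> = (\<Sum>W\<in>?F. card (W - T))"
  proof (rule card_UN_disjoint)
    show "finite ?F" by (rule finite_submodules)
    show "\<forall>W\<in>?F. finite (W - T)" using finite_submodule by auto
    show "\<forall>W\<in>?F. \<forall>W'\<in>?F. W \<noteq> W' \<longrightarrow> (W - T) \<inter> (W' - T) = {}"
    proof (intro ballI impI equals0I)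
      fix W W' w assume W: "W \<in> ?F" "W' \<in> ?F" "W \<noteq> W'" and w: "w \<in> (W - T) \<inter> (W' - T)"
      have "W = adjoin T w" using w by (intro adj W) simp
      moreover have "W' = adjoin T w" using w by (intro adj W) simp
      ultimately show False using W(3) by simp
    qed
  qed
  also have "\<dots> = card ?F * (q ^ Suc k - q ^ k)" using cWT by simp
  also have "card (U - H) = q ^ Suc m - q ^ m"
    using cU cH H fin by (simp add: card_Diff_subset)
  \<comment> \<open>Both differences carry the factor \<open>q - 1\<close>; by
    \<open>k \<le> m\<close> the quotient of the remaining powers is exact.\<close>
  also have "q ^ Suc m - q ^ m = q ^ (m - k) * (q ^ Suc k - q ^ k)"
  proof -
    obtain d where "m = k + d" using km le_Suc_ex by blast
    then show ?thesis by (simp add: power_add diff_mult_distrib2 mult_ac)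
  qed
  finally show ?thesis using q_ge_2 qk by simp
qed

text \<open>Induction on the dimension with a hyperplane \<open>H\<close> of \<open>U\<close>: a
  subspace either lies in \<open>H\<close> or meets it in a subspace \<open>T\<close> of dimension
  one less, and over each \<open>T\<close> there are \<open>q ^ (m - l)\<close> subspaces of the
  second kind. This is the recursion of \<open>gauss_poly\<close>.\<close>

lemma card_submodules:
  assumes "submodule K U V" "card U = q ^ m"
  shows "card {W. submodule K W V \<and> W \<subseteq> U \<and> card W = q ^ k} = gauss_poly q m k"
  using assms
proof (induction m arbitrary: U k)
  case 0
  then have U: "U = {\<zero>\<^bsub>V\<^esub>}" by (intro submodule_card_1) auto
  show ?case
  proof (cases k)
    case 0
    then show ?thesis using submodules_card_1[of U] "0.prems" by simp
  next
    case (Suc l)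
    have "card W \<noteq> q ^ k" if "W \<subseteq> U" for W
    proof -
      have "card W \<le> 1" using that U card_mono[of U W] by simp
      moreover have "q ^ k > 1" using q_ge_2 Suc by (intro one_less_power) auto
      ultimately show ?thesis by simp
    qed
    then have "{W. submodule K W V \<and> W \<subseteq> U \<and> card W = q ^ k} = {}" by blast
    then show ?thesis by (simp only: card.empty) (simp add: Suc)
  qed
next
  case (Suc m)
  note U = Suc.prems
  interpret U: submodule K U V by (rule U)
  have "U \<noteq> {\<zero>\<^bsub>V\<^esub>}" using U(2) one_less_power[OF q_gt_1, of "Suc m"] by auto
  then obtain H where H: "submodule K H V" "H \<subset> U"
    and adj: "\<And>w. w \<in> U - H \<Longrightarrow> adjoin H w = U" using hyperplane_exists[OF U(1)] by blast
  obtain w where w: "w \<in> U - H" using H by blast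
  then have "w \<in> carrier V" "w \<notin> H" using U.subset by blast+
  then have "card U = q * card H" using card_adjoin[OF H(1)] adj[OF w] by metis
  then have cH: "card H = q ^ m" using U(2) q_gt_1 by simp
  show ?case
  proof (cases k)
    case 0
    then show ?thesis using submodules_card_1[OF U(1)] by simp
  next
    case (Suc l)
    let ?S = "{W. submodule K W V \<and> W \<subseteq> U \<and> card W = q ^ k}"
    let ?A = "{W. submodule K W V \<and> W \<subseteq> H \<and> card W = q ^ k}"
    let ?I = "{T. submodule K T V \<and> T \<subseteq> H \<and> card T = q ^ l}"
    let ?B = "\<lambda>T. {W. submodule K W V \<and> W \<subseteq> U \<and> card W = q ^ Suc l \<and> W \<inter> H = T}"
    have int: "W \<inter> H \<in> ?I" if W: "W \<in> ?S" "\<not> W \<subseteq> H" for W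
    proof -
      obtain x where x: "x \<in> W" "x \<notin> H" using W by blast
      then have xV: "x \<in> carrier V" using W U.subset by blast
      have WV: "submodule K W V" and WU: "W \<subseteq> U" using W by simp_all
      have WH: "submodule K (W \<inter> H) V" by (rule submodule_Int[OF WV H(1)])
      \<comment> \<open>A vector of \<open>W\<close> is \<open>h\<close> plus a multiple of
        \<open>x\<close>, with \<open>h\<close> in \<open>H\<close>; as \<open>x\<close> is in
        \<open>W\<close>, so is \<open>h\<close>. Hence \<open>W \<inter> H\<close> has index
        \<open>q\<close> in \<open>W\<close>.\<close>
      have "adjoin (W \<inter> H) x = W"
      proof
        show "adjoin (W \<inter> H) x \<subseteq> W" using x by (intro adjoin_subset[OF WH xV WV]) auto
        show "W \<subseteq> adjoin (W \<inter> H) x"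
        proof
          fix y assume y: "y \<in> W"
          then have "y \<in> adjoin H x" using adj[of x] x WU by blast
          then obtain h c where hc: "h \<in> H" "c \<in> carrier K" "y = h \<oplus>\<^bsub>V\<^esub> c \<odot>\<^bsub>V\<^esub> x"
            by (auto simp: adjoin_def)
          interpret W: submodule K W V by (rule WV)
          have hV: "h \<in> carrier V" using hc H U.subset by blast
          have "y \<ominus>\<^bsub>V\<^esub> c \<odot>\<^bsub>V\<^esub> x \<in> W"
            by (intro submodule_minus[OF WV y] W.smult_closed hc x)
          also have "y \<ominus>\<^bsub>V\<^esub> c \<odot>\<^bsub>V\<^esub> x = h"
            using hc hV xV by (simp add: a_minus_def M.a_assoc M.r_neg)
          finally show "y \<in> adjoin (W \<inter> H) x" using hc by (auto simp: adjoin_def)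
        qed
      qed
      then have "card (W \<inter> H) = q ^ l"
        using card_adjoin[OF WH xV] x W Suc q_gt_1 by auto
      then show ?thesis using WH by simp
    qed
    have "?S = ?A \<union> (\<Union>T\<in>?I. ?B T)"
    proof (intro subset_antisym subsetI)
      fix W assume "W \<in> ?S"
      then show "W \<in> ?A \<union> (\<Union>T\<in>?I. ?B T)"
        using int[of W] Suc by (cases "W \<subseteq> H") auto
    qed (use H Suc in auto)
    moreover have "?A \<inter> (\<Union>T\<in>?I. ?B T) = {}"
    proof -
      \<comment> \<open>A subspace of both kinds would coincide with its intersection with
        \<open>H\<close> and so have two different cardinalities.\<close>
      have "q ^ Suc l \<noteq> q ^ l" using q_ge_2 by simp
      then show ?thesis using Suc by (auto simp: Int_absorb2)
    qed
    moreover have "finite ?A" "finite ?I" "\<And>T. finite (?B T)" by (rule finite_submodules)+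
    moreover have "finite (\<Union>T\<in>?I. ?B T)" by (intro finite_UN_I finite_submodules)
    ultimately have "card ?S = card ?A + card (\<Union>T\<in>?I. ?B T)" by (simp add: card_Un_disjoint)
    also have "card ?A = gauss_poly q m k" by (rule Suc.IH[OF H(1) cH])
    also have "card (\<Union>T\<in>?I. ?B T) = (\<Sum>T\<in>?I. card (?B T))"
      using finite_submodules by (intro card_UN_disjoint) auto
    also have "\<dots> = (\<Sum>T\<in>?I. q ^ (m - l))"
    proof (rule sum.cong[OF refl])
      fix T assume "T \<in> ?I"
      then show "card (?B T) = q ^ (m - l)"
        by (intro card_submodules_over[OF H(1) _ U(1) cH U(2)] psubset_imp_subset[OF H(2)]) auto
    qed
    also have "\<dots> = q ^ (m - l) * gauss_poly q m l" using Suc.IH[OF H(1) cH, of l] by simp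
    finally show ?thesis using Suc by simp
  qed
qed

end

text \<open>The exponent of \<open>t\<close> is the codimension \<open>m - i\<close>, whereas in \<open>space_zeta\<close> it is the dimension;
  the two sums agree by the symmetry of Gaussian binomial coefficients.\<close>

definition gauss_zeta :: "nat \<Rightarrow> nat \<Rightarrow> 'a::comm_semiring_1 \<Rightarrow> 'a" where
  "gauss_zeta q m t = (\<Sum>i\<le>m. of_nat (gauss_poly q m i) * t ^ (m - i))"

text \<open>Grouping by dimension turns the counts into coefficients. The ambient \<open>U\<close>
  is itself a subspace of \<open>V\<close>, since the later application takes for \<open>U\<close> a
  space of diagonal matrices inside \<open>tr\<close>.\<close>

lemma (in finite_vectorspace) sum_submodules_codim:
  fixes t :: "'e::comm_semiring_1"
  assumes U: "submodule K U V" and cU: "card U = q ^ m"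
  shows "(\<Sum>W | submodule K W V \<and> W \<subseteq> U. t ^ (m - vectorspace.dim K (vs W))) = gauss_zeta q m t"
proof -
  let ?S = "{W. submodule K W V \<and> W \<subseteq> U}"
  have dim: "vectorspace.dim K (vs W) \<le> m" if "W \<in> ?S" for W
  proof -
    have "card W \<le> q ^ m"
      using that cU card_mono[OF finite_submodule[OF U], of W] by simp
    then show ?thesis
      using that card_submodule[of W] power_le_imp_le_exp[OF q_gt_1] by simp
  qed
  have "(\<Sum>W\<in>?S. t ^ (m - vectorspace.dim K (vs W))) =
      (\<Sum>i\<le>m. \<Sum>W | W \<in> ?S \<and> vectorspace.dim K (vs W) = i. t ^ (m - vectorspace.dim K (vs W)))"
    using dim by (intro sum.group[symmetric] finite_submodules) auto
  also have "\<dots> = (\<Sum>i\<le>m. of_nat (gauss_poly q m i) * t ^ (m - i))"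
  proof (rule sum.cong[OF refl])
    fix i
    have eq: "{W \<in> ?S. vectorspace.dim K (vs W) = i} =
        {W. submodule K W V \<and> W \<subseteq> U \<and> card W = q ^ i}"
      using dim_submodule_eq_iff by auto
    have "(\<Sum>W | W \<in> ?S \<and> vectorspace.dim K (vs W) = i. t ^ (m - vectorspace.dim K (vs W))) =
        (\<Sum>W | W \<in> ?S \<and> vectorspace.dim K (vs W) = i. t ^ (m - i))"
      by (intro sum.cong) auto
    then show "(\<Sum>W | W \<in> ?S \<and> vectorspace.dim K (vs W) = i. t ^ (m - vectorspace.dim K (vs W))) =
        of_nat (gauss_poly q m i) * t ^ (m - i)"
      by (simp only: sum_constant eq card_submodules[OF U cU])
  qed
  finally show ?thesis by (simp only: gauss_zeta_def)
qed

section \<open>Zeta function of the standard vector space\<close>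

lemma finite_vectorspace_module_vec:
  "finite_vectorspace class_ring (module_vec TYPE('k::{field,finite}) m)"
proof -
  have "carrier_vec m \<subseteq> vec_of_list ` {xs :: 'k list. set xs \<subseteq> UNIV \<and> length xs = m}"
  proof
    fix v :: "'k vec" assume "v \<in> carrier_vec m"
    then have "v = vec_of_list (list_of_vec v)" "length (list_of_vec v) = m"
      by (simp_all add: vec_list)
    then show "v \<in> vec_of_list ` {xs. set xs \<subseteq> UNIV \<and> length xs = m}" by blast
  qed
  then have "finite (carrier_vec m :: 'k vec set)"
    by (rule finite_subset) (intro finite_imageI finite_lists_length_eq finite)
  then show ?thesis
    by (intro finite_vectorspace.intro finite_vectorspace_axioms.intro vec_vs)
      (simp_all add: module_vec_simps)
qed

lemma gauss_binomial_eq: "gauss_binomial TYPE('k::{field,finite}) m i = gauss_poly CARD('k) m i"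
proof -
  interpret V: finite_vectorspace "class_ring :: 'k ring" "module_vec TYPE('k) m"
    by (rule finite_vectorspace_module_vec)
  have "{W. VectorSpace.subspace class_ring W (module_vec TYPE('k) m) \<and>
      vectorspace.dim class_ring ((module_vec TYPE('k) m)\<lparr>carrier := W\<rparr>) = i} =
      {W. submodule class_ring W (module_vec TYPE('k) m) \<and> W \<subseteq> carrier (module_vec TYPE('k) m) \<and>
        card W = V.q ^ i}"
  proof (rule Collect_cong)
    fix W
    show "VectorSpace.subspace class_ring W (module_vec TYPE('k) m) \<and>
        vectorspace.dim class_ring ((module_vec TYPE('k) m)\<lparr>carrier := W\<rparr>) = i \<longleftrightarrow>
        submodule class_ring W (module_vec TYPE('k) m) \<and>
        W \<subseteq> carrier (module_vec TYPE('k) m) \<and> card W = V.q ^ i"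
      using V.dim_submodule_eq_iff[of W i] submodule.subset[of class_ring W "module_vec TYPE('k) m"]
      by (simp add: subspace_def V.vectorspace_axioms) metis
  qed
  moreover have "V.dim = m" by (rule vec_space.dim_is_n)
  ultimately show ?thesis
    using V.card_submodules[OF V.submodule_carrier, of m i] V.card_carrier
    unfolding gauss_binomial_def by simp
qed

lemma space_zeta_eq:
  "space_zeta TYPE('k::{field,finite}) m s =
     (\<Sum>i\<le>m. of_nat (gauss_poly CARD('k) m i) * (of_nat CARD('k) powr (- s)) ^ i)"
  by (simp only: space_zeta_def gauss_binomial_eq)

section \<open>Ideals and upper sets of roots\<close>

definition pos_roots :: "nat \<Rightarrow> (nat \<times> nat) set" where
  "pos_roots n = {(i, j). i < j \<and> j < n}"

text \<open>The pair \<open>(i, j)\<close> stands for the root with root vector \<open>E i j\<close>, so larger roots lie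
  towards the upper right corner of the matrix.\<close>

definition up_closed :: "nat \<Rightarrow> (nat \<times> nat) set \<Rightarrow> bool" where
  "up_closed n S \<longleftrightarrow> S \<subseteq> pos_roots n \<and>
     (\<forall>(i, j)\<in>S. \<forall>(k, l)\<in>pos_roots n. k \<le> i \<and> j \<le> l \<longrightarrow> (k, l) \<in> S)"

definition unit_mat :: "nat \<Rightarrow> nat \<Rightarrow> nat \<Rightarrow> 'a::zero_neq_one mat" where
  "unit_mat n i j = mat n n (\<lambda>p. if p = (i, j) then 1 else 0)"

definition diag_part :: "nat \<Rightarrow> 'a::zero mat \<Rightarrow> 'a mat" where
  "diag_part n x = mat n n (\<lambda>(i, j). if i = j then x $$ (i, j) else 0)"

text \<open>The diagonal matrices on which all roots outside \<open>S\<close> vanish: the largest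
  diagonal part available to an ideal with root set \<open>S\<close>.\<close>

definition torus :: "nat \<Rightarrow> (nat \<times> nat) set \<Rightarrow> 'a::zero mat set" where
  "torus n S = {d \<in> carrier_mat n n. diagonal_mat d \<and>
     (\<forall>(i, j)\<in>pos_roots n - S. d $$ (i, i) = d $$ (j, j))}"

definition ideal_of :: "nat \<Rightarrow> (nat \<times> nat) set \<Rightarrow> 'a::zero mat set \<Rightarrow> 'a mat set" where
  "ideal_of n S D = {x \<in> carrier_mat n n. upper_triangular x \<and>
     (\<forall>(i, j)\<in>pos_roots n - S. x $$ (i, j) = 0) \<and> diag_part n x \<in> D}"

text \<open>Together with \<open>torus_of\<close> this will be the inverse of
  \<open>ideal_of\<close>: an ideal is traded for its root set and its diagonal matrices.\<close>

definition roots_of :: "nat \<Rightarrow> 'a::zero_neq_one mat set \<Rightarrow> (nat \<times> nat) set" where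
  "roots_of n I = {(i, j) \<in> pos_roots n. unit_mat n i j \<in> I}"

definition torus_of :: "'a::zero mat set \<Rightarrow> 'a mat set" where
  "torus_of I = {d \<in> I. diagonal_mat d}"

section \<open>Matrix units and entries of brackets\<close>

lemma up_closedD:
  assumes S: "up_closed n S" and ij: "(i, j) \<in> S" and kl: "k \<le> i" "j \<le> l" "l < n"
  shows "(k, l) \<in> S"
proof -
  have "i < j" using S ij by (auto simp: up_closed_def pos_roots_def)
  then have "(k, l) \<in> pos_roots n" using kl by (simp add: pos_roots_def)
  then show ?thesis using S ij kl unfolding up_closed_def by blast
qed

lemma finite_pos_roots: "finite (pos_roots n)"
  by (rule finite_subset[of _ "{..<n} \<times> {..<n}"]) (auto simp: pos_roots_def)

lemma unit_mat_carrier [simp]: "unit_mat n i j \<in> carrier_mat n n"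
  by (simp add: unit_mat_def)

lemma dim_unit_mat [simp]: "dim_row (unit_mat n i j) = n" "dim_col (unit_mat n i j) = n"
  by (simp_all add: unit_mat_def)

lemma dim_diag_part [simp]: "dim_row (diag_part n x) = n" "dim_col (diag_part n x) = n"
  by (simp_all add: diag_part_def)

lemma index_unit_mat [simp]:
  "k < n \<Longrightarrow> l < n \<Longrightarrow> unit_mat n i j $$ (k, l) = (if k = i \<and> l = j then 1 else 0)"
  by (simp add: unit_mat_def)

lemma index_diag_part [simp]:
  "k < n \<Longrightarrow> l < n \<Longrightarrow> diag_part n x $$ (k, l) = (if k = l then x $$ (k, l) else 0)"
  by (simp add: diag_part_def)

lemma diag_part_diagonal: "x \<in> carrier_mat n n \<Longrightarrow> diagonal_mat x \<Longrightarrow> diag_part n x = x"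
  by (rule eq_matI) (auto simp: diagonal_mat_def)

lemma index_bracket:
  fixes x y :: "'a::comm_ring_1 mat"
  assumes "x \<in> carrier_mat n n" "y \<in> carrier_mat n n" "i < n" "j < n"
  shows "(x * y - y * x) $$ (i, j) =
    (\<Sum>k<n. x $$ (i, k) * y $$ (k, j)) - (\<Sum>k<n. y $$ (i, k) * x $$ (k, j))"
  using assms by (simp add: scalar_prod_def atLeast0LessThan)

text \<open>Multiplying by \<open>E a b\<close> on the left moves row \<open>b\<close> to row
  \<open>a\<close>, and on the right column \<open>a\<close> to column \<open>b\<close>. All
  explicit brackets below have such a factor.\<close>

lemma index_bracket_unit_mat:
  fixes x :: "'a::comm_ring_1 mat"
  assumes x: "x \<in> carrier_mat n n" and ab: "a < n" "b < n" and kl: "k < n" "l < n"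
  shows "(unit_mat n a b * x - x * unit_mat n a b) $$ (k, l) =
    (if k = a then x $$ (b, l) else 0) - (if l = b then x $$ (k, a) else 0)"
proof -
  have "(\<Sum>i<n. unit_mat n a b $$ (k, i) * x $$ (i, l)) =
      (\<Sum>i<n. if i = b then if k = a then x $$ (i, l) else 0 else 0)"
    using kl by (intro sum.cong) auto
  also have "\<dots> = (if k = a then x $$ (b, l) else 0)" using ab by (simp add: sum.delta)
  finally have 1: "(\<Sum>i<n. unit_mat n a b $$ (k, i) * x $$ (i, l)) = \<dots>" .
  have "(\<Sum>i<n. x $$ (k, i) * unit_mat n a b $$ (i, l)) =
      (\<Sum>i<n. if i = a then if l = b then x $$ (k, i) else 0 else 0)"
    using kl by (intro sum.cong) auto
  also have "\<dots> = (if l = b then x $$ (k, a) else 0)" using ab by (simp add: sum.delta)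
  finally have 2: "(\<Sum>i<n. x $$ (k, i) * unit_mat n a b $$ (i, l)) = \<dots>" .
  show ?thesis
    by (simp only: index_bracket[OF unit_mat_carrier x kl] 1 2)
qed

lemma finite_vectorspace_tr: "finite_vectorspace class_ring (tr TYPE('k::{field,finite}) n)"
proof -
  interpret lie_algebra class_ring "tr TYPE('k) n" by (rule lie_algebra_tr)
  have "carrier_mat n n \<subseteq> (\<lambda>f. mat n n f) ` (({..<n} \<times> {..<n}) \<rightarrow>\<^sub>E (UNIV :: 'k set))"
  proof
    fix x :: "'k mat" assume x: "x \<in> carrier_mat n n"
    let ?f = "\<lambda>p\<in>{..<n} \<times> {..<n}. x $$ p"
    have "x = mat n n ?f" using x by (intro eq_matI) auto
    moreover have "?f \<in> ({..<n} \<times> {..<n}) \<rightarrow>\<^sub>E UNIV" by simp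
    ultimately show "x \<in> (\<lambda>f. mat n n f) ` (({..<n} \<times> {..<n}) \<rightarrow>\<^sub>E UNIV)" by blast
  qed
  then have "finite (carrier_mat n n :: 'k mat set)"
    by (rule finite_subset) (intro finite_imageI finite_PiE finite_cartesian_product finite_lessThan finite)
  then show ?thesis
    by (intro finite_vectorspace.intro finite_vectorspace_axioms.intro vectorspace.intro
        module_axioms class_field) simp_all
qed

section \<open>From an ideal to its roots and its torus\<close>

context
  fixes n :: nat and I :: "'k::{field,finite} mat set"
  assumes I: "lie_ideal class_ring I (tr TYPE('k) n)"
begin

interpretation finite_vectorspace "class_ring :: 'k ring" "tr TYPE('k) n"
  by (rule finite_vectorspace_tr)

lemma lie_ideal_submodule: "submodule class_ring I (tr TYPE('k) n)"
  using I by (simp add: lie_ideal_def)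

interpretation I: submodule class_ring I "tr TYPE('k) n" by (rule lie_ideal_submodule)

lemma lie_ideal_carrier: "x \<in> I \<Longrightarrow> x \<in> carrier_mat n n" "x \<in> I \<Longrightarrow> upper_triangular x"
  using I.subset by auto

lemma lie_ideal_bracket:
  "x \<in> carrier_mat n n \<Longrightarrow> upper_triangular x \<Longrightarrow> y \<in> I \<Longrightarrow> x * y - y * x \<in> I"
  using I by (simp add: lie_ideal_def)

lemma lie_ideal_smult: "x \<in> I \<Longrightarrow> c \<cdot>\<^sub>m x \<in> I"
  using I.smult_closed[of c x] by simp

lemma lie_ideal_smult_cancel: "c \<cdot>\<^sub>m x \<in> I \<Longrightarrow> c \<noteq> 0 \<Longrightarrow> x \<in> carrier_mat n n \<Longrightarrow> x \<in> I"
proof -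
  assume x: "c \<cdot>\<^sub>m x \<in> I" "c \<noteq> 0" "x \<in> carrier_mat n n"
  then have "x = inverse c \<cdot>\<^sub>m (c \<cdot>\<^sub>m x)" by (intro eq_matI) auto
  then show "x \<in> I" using lie_ideal_smult[OF x(1), of "inverse c"] by simp
qed

lemma lie_ideal_unit_mat:
  assumes x: "x \<in> I" and ij: "i < j" "j < n" and nz: "x $$ (i, j) \<noteq> 0"
  shows "unit_mat n i j \<in> I"
proof -
  have xc: "x \<in> carrier_mat n n" and xu: "upper_triangular x" using lie_ideal_carrier x by auto
  have up: "upper_triangular (unit_mat n a a :: 'k mat)" if "a < n" for a
    using that by (auto simp: upper_triangular_def)
  \<comment> \<open>applying \<open>ad (E i i)\<close> and then \<open>ad (E j j)\<close> to \<open>x\<close> isolates the entry at \<open>(i, j)\<close>\<close>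
  define y where "y = unit_mat n i i * x - x * unit_mat n i i"
  have y: "y \<in> I" "y \<in> carrier_mat n n" unfolding y_def
    using lie_ideal_bracket[OF _ up x] xc ij by auto
  define z where "z = unit_mat n j j * y - y * unit_mat n j j"
  have z: "z \<in> I" "z \<in> carrier_mat n n" unfolding z_def
    using lie_ideal_bracket[OF _ up y(1)] y(2) ij by auto
  \<comment> \<open>The two brackets leave the positions \<open>(i, j)\<close> and
    \<open>(j, i)\<close>; upper triangularity clears the second.\<close>
  have x0: "x $$ (b, a) = 0" if "a < b" "b < n" for a b
    using xu xc that by auto
  have "z = (- x $$ (i, j)) \<cdot>\<^sub>m unit_mat n i j"
  proof (rule eq_matI)
    fix k l assume "k < dim_row ((- x $$ (i, j)) \<cdot>\<^sub>m unit_mat n i j)"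
      "l < dim_col ((- x $$ (i, j)) \<cdot>\<^sub>m unit_mat n i j)"
    then have kl: "k < n" "l < n" by simp_all
    have yy: "y $$ (a, b) = (if a = i then x $$ (i, b) else 0) - (if b = i then x $$ (a, i) else 0)"
      if "a < n" "b < n" for a b
      unfolding y_def using that ij by (intro index_bracket_unit_mat[OF xc]) auto
    have "z $$ (k, l) = (if k = j then y $$ (j, l) else 0) - (if l = j then y $$ (k, j) else 0)"
      unfolding z_def using kl ij by (intro index_bracket_unit_mat[OF y(2)]) auto
    then show "z $$ (k, l) = ((- x $$ (i, j)) \<cdot>\<^sub>m unit_mat n i j) $$ (k, l)"
      using kl ij x0[of i j] by (auto simp: yy)
  qed (use z in auto)
  then show ?thesis using z(1) lie_ideal_smult_cancel[of "- x $$ (i, j)"] nz by auto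
qed

text \<open>A matrix is the sum of its entries times matrix units. The induction erases one position
  of the support bound \<open>A\<close> and restores it as a multiple of a unit in
  \<open>I\<close>.\<close>

lemma lie_ideal_mat_sum:
  assumes "finite A" "M \<in> carrier_mat n n" "A \<subseteq> {..<n} \<times> {..<n}"
    and "\<And>i j. (i, j) \<in> ({..<n} \<times> {..<n}) - A \<Longrightarrow> M $$ (i, j) = 0"
    and "\<And>i j. (i, j) \<in> A \<Longrightarrow> M $$ (i, j) \<noteq> 0 \<Longrightarrow> unit_mat n i j \<in> I"
  shows "M \<in> I"
  using assms
proof (induction A arbitrary: M)
  case empty
  then have "M = 0\<^sub>m n n" by (intro eq_matI) auto
  then show ?case using I.zero_closed by simp
next
  case (insert p A)
  obtain i j where p: "p = (i, j)" by force
  with insert have ij: "i < n" "j < n" by auto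
  let ?M = "mat n n (\<lambda>q. if q = p then 0 else M $$ q)"
  have 1: "?M \<in> I"
  proof (rule insert.IH)
    fix k l
    show "?M $$ (k, l) = 0" if "(k, l) \<in> ({..<n} \<times> {..<n}) - A"
      using that insert.prems(3)[of k l] by auto
    show "unit_mat n k l \<in> I" if "(k, l) \<in> A" "?M $$ (k, l) \<noteq> 0"
    proof -
      have "k < n" "l < n" using that insert.prems(2) by auto
      then show ?thesis
        using that insert.prems(4)[of k l] by (auto split: if_splits)
    qed
  qed (use insert.prems in auto)
  have 2: "M $$ (i, j) \<cdot>\<^sub>m unit_mat n i j \<in> I"
  proof (cases "M $$ (i, j) = 0")
    case True
    then have "M $$ (i, j) \<cdot>\<^sub>m unit_mat n i j = (0\<^sub>m n n :: 'k mat)" by (intro eq_matI) auto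
    then show ?thesis using I.zero_closed by simp
  next
    case False
    then show ?thesis using insert.prems(4)[of i j] p by (intro lie_ideal_smult) simp
  qed
  have "M = ?M + M $$ (i, j) \<cdot>\<^sub>m unit_mat n i j"
    using insert.prems(1) ij by (intro eq_matI) (auto simp: p)
  then show ?case using I.m_closed[OF 1 2] by simp
qed

end

lemma upper_triangular_unit_mat: "i \<le> j \<Longrightarrow> j < n \<Longrightarrow> upper_triangular (unit_mat n i j)"
  by (auto simp: upper_triangular_def)

lemma diagonal_diag_part: "diagonal_mat (diag_part n x)"
  by (auto simp: diagonal_mat_def)

context
  fixes n :: nat and I :: "'k::{field,finite} mat set"
  assumes I: "lie_ideal class_ring I (tr TYPE('k) n)"
begin

interpretation finite_vectorspace "class_ring :: 'k ring" "tr TYPE('k) n"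
  by (rule finite_vectorspace_tr)

interpretation I: submodule class_ring I "tr TYPE('k) n" by (rule lie_ideal_submodule[OF I])

text \<open>\<open>[E k i, E i j] = E k j\<close>, the reverse product being zero because
  \<open>k < j\<close>.\<close>

lemma lie_ideal_unit_mat_left:
  assumes ij: "unit_mat n i j \<in> I" and "k < i" "i < j" "j < n"
  shows "unit_mat n k j \<in> I"
proof -
  have "unit_mat n k i * unit_mat n i j - unit_mat n i j * unit_mat n k i = (unit_mat n k j :: 'k mat)"
  proof (rule eq_matI)
    fix p q assume "p < dim_row (unit_mat n k j :: 'k mat)" "q < dim_col (unit_mat n k j :: 'k mat)"
    then have pq: "p < n" "q < n" by simp_all
    have ki: "k < n" "i < n" using assms by simp_all
    show "(unit_mat n k i * unit_mat n i j - unit_mat n i j * unit_mat n k i) $$ (p, q) =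
        (unit_mat n k j :: 'k mat) $$ (p, q)"
      unfolding index_bracket_unit_mat[OF unit_mat_carrier ki pq] using pq assms by auto
  qed simp_all
  then show ?thesis
    using lie_ideal_bracket[OF I unit_mat_carrier upper_triangular_unit_mat ij, of k i] assms by simp
qed

text \<open>\<open>[E j l, E i j] = - E i l\<close>, and the sign can be cancelled.\<close>

lemma lie_ideal_unit_mat_right:
  assumes ij: "unit_mat n i j \<in> I" and "i < j" "j < l" "l < n"
  shows "unit_mat n i l \<in> I"
proof -
  have "unit_mat n j l * unit_mat n i j - unit_mat n i j * unit_mat n j l =
      (- 1) \<cdot>\<^sub>m (unit_mat n i l :: 'k mat)"
  proof (rule eq_matI)
    fix p q assume "p < dim_row ((- 1) \<cdot>\<^sub>m unit_mat n i l :: 'k mat)"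
      "q < dim_col ((- 1) \<cdot>\<^sub>m unit_mat n i l :: 'k mat)"
    then have pq: "p < n" "q < n" by simp_all
    have jl: "j < n" "l < n" using assms by simp_all
    show "(unit_mat n j l * unit_mat n i j - unit_mat n i j * unit_mat n j l) $$ (p, q) =
        ((- 1) \<cdot>\<^sub>m unit_mat n i l :: 'k mat) $$ (p, q)"
      unfolding index_bracket_unit_mat[OF unit_mat_carrier jl pq] using pq assms by auto
  qed simp_all
  then have "(- 1) \<cdot>\<^sub>m (unit_mat n i l :: 'k mat) \<in> I"
    using lie_ideal_bracket[OF I unit_mat_carrier upper_triangular_unit_mat ij, of j l] assms by simp
  then show ?thesis by (rule lie_ideal_smult_cancel[OF I]) simp_all
qed

text \<open>A larger root is reached in two moves, first up from row \<open>i\<close> to row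
  \<open>k\<close>, then right from column \<open>j\<close> to column \<open>l\<close>.\<close>

lemma up_closed_roots_of: "up_closed n (roots_of n I)"
proof -
  have "(k, l) \<in> roots_of n I"
    if ij: "(i, j) \<in> roots_of n I" and kl: "(k, l) \<in> pos_roots n" "k \<le> i" "j \<le> l" for i j k l
  proof -
    have 1: "i < j" "l < n" "unit_mat n i j \<in> I" using ij kl by (auto simp: roots_of_def pos_roots_def)
    have 2: "unit_mat n k j \<in> I"
      using lie_ideal_unit_mat_left[of i j k] 1 kl by (cases "k = i") auto
    have "unit_mat n k l \<in> I"
      using lie_ideal_unit_mat_right[OF 2, of l] 1 2 kl by (cases "j = l") auto
    then show ?thesis using kl by (simp add: roots_of_def)
  qed
  moreover have "roots_of n I \<subseteq> pos_roots n" by (auto simp: roots_of_def)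
  ultimately show ?thesis by (auto simp: up_closed_def)
qed

lemma lie_ideal_index_eq_0:
  assumes "x \<in> I" "(i, j) \<in> pos_roots n - roots_of n I"
  shows "x $$ (i, j) = 0"
  using lie_ideal_unit_mat[OF I assms(1), of i j] assms(2) by (auto simp: roots_of_def pos_roots_def)

text \<open>Every nonzero entry above the diagonal sits at a root of \<open>I\<close>, whose matrix
  unit belongs to \<open>I\<close>. Membership of \<open>x\<close> in \<open>I\<close> is left open,
  so that both inclusions of \<open>ideal_of_roots_of\<close> can use this.\<close>

lemma lie_ideal_strict_part:
  assumes x: "x \<in> carrier_mat n n" "upper_triangular x"
    and "\<And>i j. (i, j) \<in> pos_roots n - roots_of n I \<Longrightarrow> x $$ (i, j) = 0"
  shows "x - diag_part n x \<in> I"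
proof (rule lie_ideal_mat_sum[OF I finite_pos_roots[of n]])
  show "pos_roots n \<subseteq> {..<n} \<times> {..<n}" by (auto simp: pos_roots_def)
  show "x - diag_part n x \<in> carrier_mat n n" using x by auto
  fix i j
  show "(x - diag_part n x) $$ (i, j) = 0" if "(i, j) \<in> {..<n} \<times> {..<n} - pos_roots n"
  proof -
    have "j \<le> i" "i < n" "j < n" using that by (auto simp: pos_roots_def)
    then show ?thesis using x by (cases "i = j") auto
  qed
  show "unit_mat n i j \<in> I" if "(i, j) \<in> pos_roots n" "(x - diag_part n x) $$ (i, j) \<noteq> 0"
  proof -
    have ij: "i < j" "j < n" using that by (auto simp: pos_roots_def)
    then have "x $$ (i, j) \<noteq> 0" using that x by simp
    then show ?thesis using assms(3)[of i j] that(1) by (auto simp: roots_of_def)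
  qed
qed

lemma lie_ideal_diag_part_iff:
  assumes x: "x \<in> carrier_mat n n" "upper_triangular x"
    and z: "\<And>i j. (i, j) \<in> pos_roots n - roots_of n I \<Longrightarrow> x $$ (i, j) = 0"
  shows "diag_part n x \<in> I \<longleftrightarrow> x \<in> I"
proof
  have N: "x - diag_part n x \<in> I" using lie_ideal_strict_part x z by blast
  show "x \<in> I" if "diag_part n x \<in> I"
  proof -
    have "x = diag_part n x + (x - diag_part n x)" using x by (intro eq_matI) auto
    then show ?thesis using I.m_closed[OF that N] by simp
  qed
  show "diag_part n x \<in> I" if "x \<in> I"
  proof -
    have "diag_part n x = x + (- 1) \<cdot>\<^sub>m (x - diag_part n x)" using x by (intro eq_matI) auto
    then show ?thesis using I.m_closed[OF that lie_ideal_smult[OF I N, of "- 1"]] by simp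
  qed
qed

text \<open>Modulo \<open>I\<close>, a matrix with entries only on the diagonal and at roots of
  \<open>I\<close> equals its diagonal part, so the roots and the diagonal elements determine
  \<open>I\<close>.\<close>

lemma ideal_of_roots_of: "ideal_of n (roots_of n I) (torus_of I) = I"
proof (intro subset_antisym subsetI)
  fix x assume "x \<in> ideal_of n (roots_of n I) (torus_of I)"
  then have "x \<in> carrier_mat n n" "upper_triangular x" "diag_part n x \<in> I"
    "\<And>i j. (i, j) \<in> pos_roots n - roots_of n I \<Longrightarrow> x $$ (i, j) = 0"
    by (auto simp: ideal_of_def torus_of_def)
  then show "x \<in> I" using lie_ideal_diag_part_iff by blast
next
  fix x assume x: "x \<in> I"
  then have xc: "x \<in> carrier_mat n n" "upper_triangular x" using lie_ideal_carrier[OF I] by auto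
  have z: "\<And>i j. (i, j) \<in> pos_roots n - roots_of n I \<Longrightarrow> x $$ (i, j) = 0"
    by (rule lie_ideal_index_eq_0[OF x])
  then have "diag_part n x \<in> I" using lie_ideal_diag_part_iff[OF xc z] x by blast
  then show "x \<in> ideal_of n (roots_of n I) (torus_of I)"
    using xc z unfolding ideal_of_def torus_of_def by (auto simp: diagonal_diag_part)
qed

lemma submodule_torus_of: "submodule class_ring (torus_of I) (tr TYPE('k) n)"
proof (rule submodule.intro)
  show "torus_of I \<subseteq> carrier (tr TYPE('k) n)" using I.subset by (auto simp: torus_of_def)
  show "\<zero>\<^bsub>tr TYPE('k) n\<^esub> \<in> torus_of I"
    using I.zero_closed by (simp add: torus_of_def diagonal_mat_def)
  fix v w assume "v \<in> torus_of I" "w \<in> torus_of I"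
  then have v: "v \<in> I" "w \<in> I" "diagonal_mat v" "diagonal_mat w" by (auto simp: torus_of_def)
  have c: "v \<in> carrier_mat n n" "w \<in> carrier_mat n n" using lie_ideal_carrier[OF I] v by auto
  have "diagonal_mat (v + w)" using v(3,4) c by (auto simp: diagonal_mat_def)
  then show "v \<oplus>\<^bsub>tr TYPE('k) n\<^esub> w \<in> torus_of I"
    using I.m_closed[OF v(1,2)] by (simp add: torus_of_def)
next
  fix c :: 'k and v assume "v \<in> torus_of I"
  then have v: "v \<in> I" "diagonal_mat v" by (auto simp: torus_of_def)
  have "diagonal_mat (c \<cdot>\<^sub>m v)" using v(2) by (auto simp: diagonal_mat_def)
  then show "c \<odot>\<^bsub>tr TYPE('k) n\<^esub> v \<in> torus_of I"
    using lie_ideal_smult[OF I v(1)] by (simp add: torus_of_def)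
qed (rule module_axioms)

text \<open>Bracketing \<open>E i j\<close> with a diagonal \<open>d\<close> scales it by
  \<open>d j - d i\<close>. If this scalar is nonzero, it can be divided out, which puts
  \<open>E i j\<close> into \<open>I\<close> and \<open>(i, j)\<close> among its roots.\<close>

lemma torus_of_subset: "torus_of I \<subseteq> torus n (roots_of n I)"
proof
  fix d assume "d \<in> torus_of I"
  then have d: "d \<in> I" "diagonal_mat d" by (auto simp: torus_of_def)
  have dc: "d \<in> carrier_mat n n" using lie_ideal_carrier[OF I] d by auto
  have "d $$ (i, i) = d $$ (j, j)" if ij: "(i, j) \<in> pos_roots n - roots_of n I" for i j
  proof (rule ccontr)
    assume ne: "d $$ (i, i) \<noteq> d $$ (j, j)"
    have lt: "i < j" "j < n" "i < n" using ij by (auto simp: pos_roots_def)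
    have "unit_mat n i j * d - d * unit_mat n i j = (d $$ (j, j) - d $$ (i, i)) \<cdot>\<^sub>m unit_mat n i j"
    proof (rule eq_matI)
      fix p q assume "p < dim_row ((d $$ (j, j) - d $$ (i, i)) \<cdot>\<^sub>m unit_mat n i j)"
        "q < dim_col ((d $$ (j, j) - d $$ (i, i)) \<cdot>\<^sub>m unit_mat n i j)"
      then have pq: "p < n" "q < n" by simp_all
      show "(unit_mat n i j * d - d * unit_mat n i j) $$ (p, q) =
          ((d $$ (j, j) - d $$ (i, i)) \<cdot>\<^sub>m unit_mat n i j) $$ (p, q)"
        unfolding index_bracket_unit_mat[OF dc lt(3,2) pq]
        using pq lt d(2) dc by (auto simp: diagonal_mat_def)
    qed (use dc in auto)
    then have "(d $$ (j, j) - d $$ (i, i)) \<cdot>\<^sub>m unit_mat n i j \<in> I"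
      using lie_ideal_bracket[OF I unit_mat_carrier upper_triangular_unit_mat d(1), of i j] lt by simp
    then have "unit_mat n i j \<in> I"
      by (rule lie_ideal_smult_cancel[OF I]) (use ne in simp_all)
    then show False using ij by (auto simp: roots_of_def)
  qed
  then show "d \<in> torus n (roots_of n I)" using d dc by (auto simp: torus_def)
qed

end

section \<open>From a root set and a torus subspace to an ideal\<close>

context
  fixes n :: nat and S and D :: "'k::{field,finite} mat set"
  assumes S: "up_closed n S" and D: "submodule class_ring D (tr TYPE('k) n)" and DT: "D \<subseteq> torus n S"
begin

interpretation finite_vectorspace "class_ring :: 'k ring" "tr TYPE('k) n"
  by (rule finite_vectorspace_tr)

interpretation D: submodule class_ring D "tr TYPE('k) n" by (rule D)

lemma zero_mem_torus_submodule: "0\<^sub>m n n \<in> D"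
  using D.zero_closed by simp

lemma submodule_ideal_of: "submodule class_ring (ideal_of n S D) (tr TYPE('k) n)"
proof (rule submodule.intro)
  show "ideal_of n S D \<subseteq> carrier (tr TYPE('k) n)" by (auto simp: ideal_of_def)
  have "diag_part n (0\<^sub>m n n) = (0\<^sub>m n n :: 'k mat)" by (intro eq_matI) auto
  then show "\<zero>\<^bsub>tr TYPE('k) n\<^esub> \<in> ideal_of n S D"
    using zero_mem_torus_submodule by (auto simp: ideal_of_def pos_roots_def upper_triangular_def)
  fix v w assume "v \<in> ideal_of n S D" "w \<in> ideal_of n S D"
  then have v: "v \<in> carrier_mat n n" "upper_triangular v" "diag_part n v \<in> D"
      "\<forall>(i, j)\<in>pos_roots n - S. v $$ (i, j) = 0"
    and w: "w \<in> carrier_mat n n" "upper_triangular w" "diag_part n w \<in> D"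
      "\<forall>(i, j)\<in>pos_roots n - S. w $$ (i, j) = 0"
    by (auto simp: ideal_of_def)
  have "diag_part n (v + w) = diag_part n v + diag_part n w" using v w by (intro eq_matI) auto
  then have "diag_part n (v + w) \<in> D" using D.m_closed[OF v(3) w(3)] by simp
  moreover have "\<forall>(i, j)\<in>pos_roots n - S. (v + w) $$ (i, j) = 0"
  proof clarify
    fix i j assume ij: "(i, j) \<in> pos_roots n" "(i, j) \<notin> S"
    then have "v $$ (i, j) = 0" "w $$ (i, j) = 0" using v(4) w(4) by auto
    moreover have "i < n" "j < n" using ij by (auto simp: pos_roots_def)
    ultimately show "(v + w) $$ (i, j) = 0" using v(1) w(1) by simp
  qed
  moreover have "upper_triangular (v + w)" using v(1,2) w(1,2) by (auto simp: upper_triangular_def)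
  ultimately show "v \<oplus>\<^bsub>tr TYPE('k) n\<^esub> w \<in> ideal_of n S D" using v w by (simp add: ideal_of_def)
next
  fix c :: 'k and v assume "v \<in> ideal_of n S D"
  then have v: "v \<in> carrier_mat n n" "upper_triangular v" "diag_part n v \<in> D"
      "\<forall>(i, j)\<in>pos_roots n - S. v $$ (i, j) = 0"
    by (auto simp: ideal_of_def)
  have "diag_part n (c \<cdot>\<^sub>m v) = c \<cdot>\<^sub>m diag_part n v" using v by (intro eq_matI) auto
  then have "diag_part n (c \<cdot>\<^sub>m v) \<in> D" using D.smult_closed[OF _ v(3), of c] by simp
  moreover have "\<forall>(i, j)\<in>pos_roots n - S. (c \<cdot>\<^sub>m v) $$ (i, j) = 0"
  proof clarify
    fix i j assume ij: "(i, j) \<in> pos_roots n" "(i, j) \<notin> S"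
    then have "v $$ (i, j) = 0" using v(4) by auto
    moreover have "i < n" "j < n" using ij by (auto simp: pos_roots_def)
    ultimately show "(c \<cdot>\<^sub>m v) $$ (i, j) = 0" using v(1) by simp
  qed
  moreover have "upper_triangular (c \<cdot>\<^sub>m v)" using v(1,2) by (auto simp: upper_triangular_def)
  ultimately show "c \<odot>\<^bsub>tr TYPE('k) n\<^esub> v \<in> ideal_of n S D" using v by (simp add: ideal_of_def)
qed (rule module_axioms)

text \<open>Brackets of upper-triangular matrices have zero diagonal. At a root
  \<open>(i, j)\<close> outside \<open>S\<close> the only surviving terms give
  \<open>x i j * (y j j - y i i)\<close>, which vanishes because the diagonal of \<open>y\<close>
  lies in the torus of \<open>S\<close>.\<close>

lemma bracket_mem_ideal_of:
  assumes x: "x \<in> carrier_mat n n" "upper_triangular x" and y: "y \<in> ideal_of n S D"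
  shows "x * y - y * x \<in> ideal_of n S D"
proof -
  have yc: "y \<in> carrier_mat n n" "upper_triangular y"
    and y0: "\<And>i j. (i, j) \<in> pos_roots n \<Longrightarrow> (i, j) \<notin> S \<Longrightarrow> y $$ (i, j) = 0"
    and yD: "diag_part n y \<in> torus n S"
    using y DT by (auto simp: ideal_of_def)
  have low: "x $$ (i, j) = 0" "y $$ (i, j) = 0" if "j < i" "i < n" for i j
    using that x yc by auto
  have "upper_triangular (x * y)" "upper_triangular (y * x)"
    using upper_triangular_mult x yc by blast+
  then have up: "upper_triangular (x * y - y * x)" using x yc by (auto simp: upper_triangular_def)
  have diag: "(x * y - y * x) $$ (i, i) = 0" if i: "i < n" for i
  proof -
    have "(\<Sum>k<n. x $$ (i, k) * y $$ (k, i)) = (\<Sum>k<n. y $$ (i, k) * x $$ (k, i))"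
    proof (rule sum.cong[OF refl])
      fix k assume "k \<in> {..<n}"
      then show "x $$ (i, k) * y $$ (k, i) = y $$ (i, k) * x $$ (k, i)"
        \<comment> \<open>Triangularity of both factors leaves only the term \<open>k = i\<close>,
          where the entries commute.\<close>
        using low[of i k] low[of k i] i by (cases i k rule: linorder_cases) auto
    qed
    then show ?thesis by (simp only: index_bracket[OF x(1) yc(1) i i]) simp
  qed
  have off: "(x * y - y * x) $$ (i, j) = 0" if ij: "(i, j) \<in> pos_roots n" "(i, j) \<notin> S" for i j
  proof -
    have lt: "i < j" "j < n" "i < n" using ij by (auto simp: pos_roots_def)
    \<comment> \<open>Up-closure read contrapositively: below a root outside \<open>S\<close> there
      are no roots of \<open>S\<close>, so \<open>y\<close> vanishes strictly above the diagonal
      between row \<open>i\<close> and column \<open>j\<close>.\<close>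
    have notin: "(k, l) \<notin> S" if "i \<le> k" "l \<le> j" for k l
      using S ij that unfolding up_closed_def by blast
    have y0': "y $$ (k, l) = 0" if "i \<le> k" "k < l" "l \<le> j" for k l
      using that lt notin by (intro y0) (auto simp: pos_roots_def)
    have "(\<Sum>k<n. x $$ (i, k) * y $$ (k, j)) = (\<Sum>k<n. if k = j then x $$ (i, j) * y $$ (j, j) else 0)"
    proof (rule sum.cong[OF refl])
      fix k assume "k \<in> {..<n}"
      then show "x $$ (i, k) * y $$ (k, j) = (if k = j then x $$ (i, j) * y $$ (j, j) else 0)"
        using low(1)[of k i] low(2)[of j k] y0'[of k j] lt
        by (cases "k < i"; cases k j rule: linorder_cases) auto
    qed
    also have "\<dots> = x $$ (i, j) * y $$ (j, j)" using lt by (simp add: sum.delta)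
    finally have 1: "(\<Sum>k<n. x $$ (i, k) * y $$ (k, j)) = x $$ (i, j) * y $$ (j, j)" .
    have "(\<Sum>k<n. y $$ (i, k) * x $$ (k, j)) = (\<Sum>k<n. if k = i then y $$ (i, i) * x $$ (i, j) else 0)"
    proof (rule sum.cong[OF refl])
      fix k assume "k \<in> {..<n}"
      then show "y $$ (i, k) * x $$ (k, j) = (if k = i then y $$ (i, i) * x $$ (i, j) else 0)"
        using low(2)[of k i] low(1)[of j k] y0'[of i k] lt
        by (cases "j < k"; cases k i rule: linorder_cases) auto
    qed
    also have "\<dots> = y $$ (i, i) * x $$ (i, j)" using lt by (simp add: sum.delta)
    finally have 2: "(\<Sum>k<n. y $$ (i, k) * x $$ (k, j)) = y $$ (i, i) * x $$ (i, j)" .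
    have "diag_part n y $$ (i, i) = diag_part n y $$ (j, j)" using yD ij by (auto simp: torus_def)
    then have "y $$ (i, i) = y $$ (j, j)" using lt by simp
    then show ?thesis by (simp only: index_bracket[OF x(1) yc(1) lt(3,2)] 1 2) simp
  qed
  have "diag_part n (x * y - y * x) = 0\<^sub>m n n" using diag by (intro eq_matI) auto
  then have "diag_part n (x * y - y * x) \<in> D" using zero_mem_torus_submodule by simp
  moreover have "x * y - y * x \<in> carrier_mat n n"
    by (intro minus_carrier_mat mult_carrier_mat[OF yc(1) x(1)])
  ultimately show ?thesis using up off by (auto simp: ideal_of_def)
qed

lemma lie_ideal_ideal_of: "lie_ideal class_ring (ideal_of n S D) (tr TYPE('k) n)"
  using submodule_ideal_of bracket_mem_ideal_of by (simp add: lie_ideal_def)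

lemma roots_of_ideal_of: "roots_of n (ideal_of n S D) = S"
proof -
  have "unit_mat n i j \<in> ideal_of n S D \<longleftrightarrow> (i, j) \<in> S" if ij: "(i, j) \<in> pos_roots n" for i j
  proof -
    have lt: "i < j" "j < n" using ij by (auto simp: pos_roots_def)
    have "diag_part n (unit_mat n i j) = (0\<^sub>m n n :: 'k mat)" using lt by (intro eq_matI) auto
    then have "unit_mat n i j \<in> ideal_of n S D \<longleftrightarrow>
        (\<forall>(k, l)\<in>pos_roots n - S. (unit_mat n i j :: 'k mat) $$ (k, l) = 0)"
      using zero_mem_torus_submodule lt by (simp add: ideal_of_def upper_triangular_unit_mat)
    also have "\<dots> \<longleftrightarrow> (i, j) \<in> S"
    proof
      assume *: "\<forall>(k, l)\<in>pos_roots n - S. (unit_mat n i j :: 'k mat) $$ (k, l) = 0"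
      show "(i, j) \<in> S"
      proof (rule ccontr)
        assume "(i, j) \<notin> S"
        then have "(unit_mat n i j :: 'k mat) $$ (i, j) = 0" using * ij by blast
        then show False using lt by simp
      qed
    next
      assume "(i, j) \<in> S"
      then show "\<forall>(k, l)\<in>pos_roots n - S. (unit_mat n i j :: 'k mat) $$ (k, l) = 0"
        by (auto simp: pos_roots_def)
    qed
    finally show ?thesis .
  qed
  moreover have "S \<subseteq> pos_roots n" using S by (simp add: up_closed_def)
  ultimately show ?thesis by (auto simp: roots_of_def)
qed

lemma torus_of_ideal_of: "torus_of (ideal_of n S D) = D"
proof (intro subset_antisym subsetI)
  fix d assume "d \<in> torus_of (ideal_of n S D)"
  then have "d \<in> carrier_mat n n" "diagonal_mat d" "diag_part n d \<in> D"
    by (auto simp: torus_of_def ideal_of_def)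
  then show "d \<in> D" using diag_part_diagonal by metis
next
  fix d assume d: "d \<in> D"
  then have "d \<in> torus n S" using DT by blast
  then have dc: "d \<in> carrier_mat n n" "diagonal_mat d" by (auto simp: torus_def)
  then have "upper_triangular d" "\<forall>(i, j)\<in>pos_roots n - S. d $$ (i, j) = 0"
    by (auto simp: upper_triangular_def diagonal_mat_def pos_roots_def)
  then show "d \<in> torus_of (ideal_of n S D)"
    using d dc diag_part_diagonal[OF dc] by (simp add: torus_of_def ideal_of_def)
qed

text \<open>An element amounts to a free choice of its diagonal part in \<open>D\<close> and of its
  entries at the positions in \<open>S\<close>.\<close>

lemma card_ideal_of: "card (ideal_of n S D) = card D * CARD('k) ^ card S"
proof -
  have fS: "finite S" using S finite_subset finite_pos_roots by (auto simp: up_closed_def)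
  have SS: "S \<subseteq> pos_roots n" using S by (simp add: up_closed_def)
  \<comment> \<open>No position in \<open>S\<close> is diagonal, so overwriting \<open>d\<close> by
    \<open>f\<close> on \<open>S\<close> keeps the diagonal of \<open>d\<close>.\<close>
  let ?m = "\<lambda>(d, f). mat n n (\<lambda>p. if p \<in> S then f p else d $$ p) :: 'k mat"
  let ?r = "\<lambda>x. (diag_part n x, \<lambda>p\<in>S. x $$ p)"
  have diag: "d \<in> carrier_mat n n \<and> diagonal_mat d" if "d \<in> D" for d
    using that DT by (auto simp: torus_def)
  have Sd: "i < j \<and> j < n" if "(i, j) \<in> S" for i j
    using that SS by (auto simp: pos_roots_def)
  have dm: "diag_part n (?m (d, f)) = d" if "d \<in> D" for d f
  proof (rule eq_matI)
    fix i j assume "i < dim_row d" "j < dim_col d"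
    then show "diag_part n (?m (d, f)) $$ (i, j) = d $$ (i, j)"
      using diag[OF that] Sd[of i i] by (auto simp: diagonal_mat_def)
  qed (use diag[OF that] in auto)
  have "bij_betw ?r (ideal_of n S D) (D \<times> (S \<rightarrow>\<^sub>E UNIV))"
  proof (rule bij_betw_byWitness[where f' = ?m])
    show "\<forall>x\<in>ideal_of n S D. ?m (?r x) = x"
    proof
      fix x assume x: "x \<in> ideal_of n S D"
      then have xc: "x \<in> carrier_mat n n" "upper_triangular x" by (auto simp: ideal_of_def)
      have x0: "x $$ (i, j) = 0" if "(i, j) \<notin> S" "i \<noteq> j" "i < n" "j < n" for i j
      proof (cases "i < j")
        case True
        then show ?thesis using x that by (auto simp: ideal_of_def pos_roots_def)
      next
        case False
        then show ?thesis using xc that by auto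
      qed
      show "?m (?r x) = x"
        using xc x0 by (intro eq_matI) auto
    qed
    show "\<forall>p\<in>D \<times> (S \<rightarrow>\<^sub>E UNIV). ?r (?m p) = p"
    proof
      fix p assume "p \<in> D \<times> (S \<rightarrow>\<^sub>E (UNIV :: 'k set))"
      then obtain d f where p: "p = (d, f)" and d: "d \<in> D" and f: "f \<in> S \<rightarrow>\<^sub>E UNIV" by blast
      have "(\<lambda>p\<in>S. ?m (d, f) $$ p) = f"
        using f Sd by (intro ext) (force simp: restrict_def PiE_def extensional_def)
      then show "?r (?m p) = p" using dm[OF d] p by simp
    qed
    show "?r ` ideal_of n S D \<subseteq> D \<times> (S \<rightarrow>\<^sub>E UNIV)" by (auto simp: ideal_of_def)
    show "?m ` (D \<times> (S \<rightarrow>\<^sub>E UNIV)) \<subseteq> ideal_of n S D"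
    proof (rule image_subsetI, clarify)
      fix d and f :: "nat \<times> nat \<Rightarrow> 'k" assume d: "d \<in> D"
      have "upper_triangular (?m (d, f))"
        using diag[OF d] Sd by (fastforce simp: upper_triangular_def diagonal_mat_def)
      moreover have "\<forall>(i, j)\<in>pos_roots n - S. ?m (d, f) $$ (i, j) = 0"
        using diag[OF d] by (auto simp: diagonal_mat_def pos_roots_def)
      ultimately show "mat n n (\<lambda>p. if p \<in> S then f p else d $$ p) \<in> ideal_of n S D"
        using dm[OF d, of f] d by (simp add: ideal_of_def)
    qed
  qed
  then have "card (ideal_of n S D) = card (D \<times> (S \<rightarrow>\<^sub>E (UNIV :: 'k set)))" by (rule bij_betw_same_card)
  then show ?thesis using fS by (simp add: card_cartesian_product card_PiE)
qed

end

section \<open>The sum over upper sets\<close>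

definition broken :: "nat \<Rightarrow> (nat \<times> nat) set \<Rightarrow> nat set" where
  "broken n S = {k. Suc k < n \<and> (k, Suc k) \<notin> S}"

text \<open>A diagonal matrix on which the simple roots missing from \<open>S\<close> vanish is a sequence that is constant
  along the corresponding steps.\<close>

definition chains :: "nat \<Rightarrow> nat set \<Rightarrow> (nat \<Rightarrow> 'a) set" where
  "chains n B = {f \<in> {..<n} \<rightarrow>\<^sub>E UNIV. \<forall>k\<in>B. Suc k < n \<longrightarrow> f (Suc k) = f k}"

lemma finite_chains: "finite (chains n B :: (nat \<Rightarrow> 'a::finite) set)"
  by (rule finite_subset[of _ "{..<n} \<rightarrow>\<^sub>E UNIV"]) (auto simp: chains_def intro: finite_PiE)

text \<open>The value appended at position \<open>n\<close> is forced if the step into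
  \<open>n\<close> belongs to \<open>B\<close> and free otherwise, including for
  \<open>n = 0\<close>.\<close>

lemma chains_Suc:
  "chains (Suc n) B =
     (\<lambda>(f, c). f(n := c)) ` Sigma (chains n B) (\<lambda>f. {c. \<forall>k\<in>B. Suc k = n \<longrightarrow> c = f k})"
proof (intro subset_antisym subsetI)
  fix g assume g: "g \<in> chains (Suc n) B"
  let ?f = "restrict g {..<n}"
  have "?f \<in> chains n B" using g by (auto simp: chains_def)
  moreover have "\<forall>k\<in>B. Suc k = n \<longrightarrow> g n = ?f k" using g by (auto simp: chains_def)
  moreover have "g = ?f(n := g n)"
  proof
    fix k
    show "g k = (?f(n := g n)) k"
      using g by (cases "k = n"; cases "k < n") (auto simp: chains_def PiE_def extensional_def)
  qed
  ultimately show "g \<in> (\<lambda>(f, c). f(n := c)) ` Sigma (chains n B) (\<lambda>f. {c. \<forall>k\<in>B. Suc k = n \<longrightarrow> c = f k})"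
    by (intro image_eqI[of _ _ "(?f, g n)"]) auto
next
  fix g assume "g \<in> (\<lambda>(f, c). f(n := c)) ` Sigma (chains n B) (\<lambda>f. {c. \<forall>k\<in>B. Suc k = n \<longrightarrow> c = f k})"
  then obtain f c where f: "f \<in> chains n B" and c: "\<forall>k\<in>B. Suc k = n \<longrightarrow> c = f k" and g: "g = f(n := c)"
    by auto
  have "g \<in> {..<Suc n} \<rightarrow>\<^sub>E UNIV"
    using f by (auto simp: g chains_def PiE_def extensional_def)
  moreover have "g (Suc k) = g k" if "k \<in> B" "Suc k < Suc n" for k
    using f c that by (cases "Suc k = n") (auto simp: g chains_def)
  ultimately show "g \<in> chains (Suc n) B" by (simp add: chains_def)
qed

lemma card_chains:
  "card (chains n B :: (nat \<Rightarrow> 'a::finite) set) = CARD('a) ^ (n - card {k \<in> B. Suc k < n})"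
proof (induction n)
  case 0
  have "chains 0 B = {\<lambda>_. undefined :: 'a}" by (auto simp: chains_def)
  then show ?case by simp
next
  case (Suc n)
  let ?C = "\<lambda>n. {k \<in> B. Suc k < n}"
  let ?F = "\<lambda>f :: nat \<Rightarrow> 'a. {c. \<forall>k\<in>B. Suc k = n \<longrightarrow> c = f k}"
  have sub: "?C n \<subseteq> {..<n}" by auto
  then have fin: "finite (?C n)" by (rule finite_subset) simp
  \<comment> \<open>Ensures that the truncated exponent grows by one when a free value is
    appended.\<close>
  have le: "card (?C n) \<le> n" using card_mono[OF finite_lessThan sub] by simp
  have "inj_on (\<lambda>(f, c). f(n := c)) (Sigma (chains n B) ?F)"
  proof (rule inj_onI, clarify)
    fix f g :: "nat \<Rightarrow> 'a" and c d assume f: "f \<in> chains n B" "g \<in> chains n B" and eq: "f(n := c) = g(n := d)"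
    have "f k = g k" for k
    proof (cases "k = n")
      case True
      then show ?thesis using f by (simp add: chains_def PiE_def extensional_def)
    next
      case False
      then show ?thesis using fun_cong[OF eq, of k] by simp
    qed
    moreover have "c = d" using fun_cong[OF eq, of n] by simp
    ultimately show "f = g \<and> c = d" by blast
  qed
  then have "card (chains (Suc n) B :: (nat \<Rightarrow> 'a) set) = card (Sigma (chains n B) ?F)"
    unfolding chains_Suc by (rule card_image)
  also have "\<dots> = (\<Sum>f\<in>chains n B. card (?F f))" by (rule card_SigmaI) (simp_all add: finite_chains)
  finally have *: "card (chains (Suc n) B :: (nat \<Rightarrow> 'a) set) = (\<Sum>f\<in>chains n B. card (?F f))" .
  show ?case
  proof (cases "\<exists>k\<in>B. Suc k = n")
    case True
    then obtain k where k: "k \<in> B" "Suc k = n" by blast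
    have "?F f = {f k}" for f using k by auto
    then have "card (chains (Suc n) B :: (nat \<Rightarrow> 'a) set) = card (chains n B :: (nat \<Rightarrow> 'a) set)" using * by simp
    moreover have "?C (Suc n) = insert k (?C n)" using k by auto
    then have "card (?C (Suc n)) = Suc (card (?C n))" using k fin by simp
    ultimately show ?thesis using Suc by simp
  next
    case False
    then have "?F f = UNIV" for f by blast
    then have "card (chains (Suc n) B :: (nat \<Rightarrow> 'a) set) = card (chains n B :: (nat \<Rightarrow> 'a) set) * CARD('a)"
      using * by simp
    moreover have "?C (Suc n) = ?C n" using False by (auto simp: less_Suc_eq)
    ultimately show ?thesis using Suc le by (simp add: Suc_diff_le)
  qed
qed

text \<open>Equality of diagonal entries along the missing simple roots implies it along every root
  outside \<open>S\<close>, so the torus is a set of chains and each missing simple root costs one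
  dimension.\<close>

lemma card_torus:
  assumes S: "up_closed n S"
  shows "card (torus n S :: 'k::{zero,finite} mat set) = CARD('k) ^ (n - card (broken n S))"
proof -
  let ?m = "\<lambda>f :: nat \<Rightarrow> 'k. mat n n (\<lambda>(i, j). if i = j then f i else 0)"
  have torus_eq: "torus n S = ?m ` chains n (broken n S)"
  proof (intro subset_antisym subsetI)
    fix d :: "'k mat" assume "d \<in> torus n S"
    then have d: "d \<in> carrier_mat n n" "diagonal_mat d"
      and eq: "\<And>i j. (i, j) \<in> pos_roots n \<Longrightarrow> (i, j) \<notin> S \<Longrightarrow> d $$ (i, i) = d $$ (j, j)"
      by (auto simp: torus_def)
    let ?f = "\<lambda>i\<in>{..<n}. d $$ (i, i)"
    have "d = ?m ?f" using d by (intro eq_matI) (auto simp: diagonal_mat_def)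
    moreover have "?f \<in> chains n (broken n S)"
      using eq[symmetric] by (auto simp: chains_def broken_def pos_roots_def)
    ultimately show "d \<in> ?m ` chains n (broken n S)" by blast
  next
    fix d assume "d \<in> ?m ` chains n (broken n S)"
    then obtain f where f: "f \<in> chains n (broken n S)" and d: "d = ?m f" by blast
    have chain: "f (Suc k) = f k" if "Suc k < n" "(k, Suc k) \<notin> S" for k
      using f that by (auto simp: chains_def broken_def)
    have fij: "f i = f j" if ij: "i < j" "j < n" "(i, j) \<notin> S" for i j
    proof -
      \<comment> \<open>Each simple root \<open>(k, Suc k)\<close> between \<open>i\<close> and
        \<open>j\<close> lies below \<open>(i, j)\<close> and is therefore missing from
        \<open>S\<close>; the equalities propagate from \<open>i\<close> to \<open>j\<close> one
        step at a time.\<close>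
      have up: "k \<le> j \<longrightarrow> f k = f i" if "i \<le> k" for k
        using that
      proof (induction k rule: dec_induct)
        case (step k)
        show ?case
        proof
          assume kj: "Suc k \<le> j"
          then have "(k, Suc k) \<notin> S" using up_closedD[OF S _ step.hyps(1)] ij by blast
          then show "f (Suc k) = f i" using chain[of k] step.IH kj ij by simp
        qed
      qed simp
      show ?thesis using up[of j] ij by simp
    qed
    have "d $$ (i, i) = d $$ (j, j)" if "(i, j) \<in> pos_roots n - S" for i j
      using that fij[of i j] by (simp add: d pos_roots_def)
    then show "d \<in> torus n S"
      by (auto simp: torus_def) (auto simp: d diagonal_mat_def)
  qed
  have "inj_on ?m (chains n (broken n S))"
  proof (rule inj_onI)
    fix f g assume f: "f \<in> chains n (broken n S)" "g \<in> chains n (broken n S)" and eq: "?m f = ?m g"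
    show "f = g"
    proof
      fix k
      show "f k = g k"
      proof (cases "k < n")
        case True
        have "?m f $$ (k, k) = ?m g $$ (k, k)" by (simp only: eq)
        then show ?thesis using True by simp
      next
        case False
        then show ?thesis using f by (simp add: chains_def PiE_def extensional_def)
      qed
    qed
  qed
  then have "card (torus n S :: 'k mat set) = card (chains n (broken n S) :: (nat \<Rightarrow> 'k) set)"
    unfolding torus_eq by (rule card_image)
  moreover have "{k \<in> broken n S. Suc k < n} = broken n S" by (auto simp: broken_def)
  ultimately show ?thesis by (simp add: card_chains)
qed

lemma card_broken_le: "card (broken n S) \<le> n"
proof -
  have "broken n S \<subseteq> {..<n}" by (auto simp: broken_def)
  then show ?thesis using card_mono[of "{..<n}" "broken n S"] by simp
qed

lemma submodule_torus: "submodule class_ring (torus n S) (tr TYPE('k::{field,finite}) n)"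
proof -
  interpret finite_vectorspace "class_ring :: 'k ring" "tr TYPE('k) n"
    by (rule finite_vectorspace_tr)
  show ?thesis
  proof (rule submodule.intro)
    show "torus n S \<subseteq> carrier (tr TYPE('k) n)"
      by (auto simp: torus_def diagonal_mat_def upper_triangular_def)
    show "\<zero>\<^bsub>tr TYPE('k) n\<^esub> \<in> torus n S"
      by (auto simp: torus_def diagonal_mat_def pos_roots_def)
    fix v w :: "'k mat" assume vw: "v \<in> torus n S" "w \<in> torus n S"
    have "v $$ (i, i) = v $$ (j, j)" "w $$ (i, i) = w $$ (j, j)" if "(i, j) \<in> pos_roots n - S" for i j
      using vw that by (auto simp: torus_def)
    then have "(v + w) $$ (i, i) = (v + w) $$ (j, j)" if "(i, j) \<in> pos_roots n - S" for i j
      using vw that by (auto simp: torus_def pos_roots_def)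
    then show "v \<oplus>\<^bsub>tr TYPE('k) n\<^esub> w \<in> torus n S"
      using vw by (auto simp: torus_def) (auto simp: diagonal_mat_def)
  next
    fix c :: 'k and v :: "'k mat" assume v: "v \<in> torus n S"
    have "v $$ (i, i) = v $$ (j, j)" if "(i, j) \<in> pos_roots n - S" for i j
      using v that by (auto simp: torus_def)
    then have "(c \<cdot>\<^sub>m v) $$ (i, i) = (c \<cdot>\<^sub>m v) $$ (j, j)" if "(i, j) \<in> pos_roots n - S" for i j
      using v that by (auto simp: torus_def pos_roots_def)
    then show "c \<odot>\<^bsub>tr TYPE('k) n\<^esub> v \<in> torus n S"
      using v by (auto simp: torus_def) (auto simp: diagonal_mat_def)
  qed (rule module_axioms)
qed

lemma up_closed_pos_roots: "up_closed n (pos_roots n)"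
  by (auto simp: up_closed_def)

section \<open>Codimensions and the zeta function as a sum over upper sets\<close>

text \<open>The whole algebra is \<open>ideal_of\<close> for the set of all positive roots and its
  torus, which consists of all diagonal matrices, so the count for ideals gives its size.\<close>

lemma dim_tr: "vectorspace.dim class_ring (tr TYPE('k::{field,finite}) n) = n + card (pos_roots n)"
proof -
  interpret finite_vectorspace "class_ring :: 'k ring" "tr TYPE('k) n"
    by (rule finite_vectorspace_tr)
  have "ideal_of n (pos_roots n) (torus n (pos_roots n)) = carrier (tr TYPE('k) n)"
    by (auto simp: ideal_of_def torus_def diagonal_diag_part)
  moreover have "broken n (pos_roots n) = {}" by (auto simp: broken_def pos_roots_def)
  ultimately have "card (carrier (tr TYPE('k) n)) = CARD('k) ^ (n + card (pos_roots n))"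
    using card_ideal_of[OF up_closed_pos_roots submodule_torus subset_refl, of n, where ?'k = 'k]
      card_torus[OF up_closed_pos_roots, of n, where ?'k = 'k]
    by (simp add: power_add)
  then have "CARD('k) ^ dim = CARD('k) ^ (n + card (pos_roots n))" using card_carrier by simp
  then show ?thesis using power_inject_exp[OF q_gt_1] by simp
qed

text \<open>The summands are the number of missing root spaces, the codimension of the torus of
  \<open>S\<close> among diagonal matrices, and the codimension of \<open>D\<close> in that
  torus.\<close>

lemma codim_ideal_of:
  fixes D :: "'k::{field,finite} mat set"
  assumes S: "up_closed n S" and D: "submodule class_ring D (tr TYPE('k) n)" and DT: "D \<subseteq> torus n S"
  shows "codim class_ring (ideal_of n S D) (tr TYPE('k) n) =
    card (pos_roots n - S) + card (broken n S) +
      (n - card (broken n S) - vectorspace.dim class_ring ((tr TYPE('k) n)\<lparr>carrier := D\<rparr>))"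
proof -
  interpret finite_vectorspace "class_ring :: 'k ring" "tr TYPE('k) n"
    by (rule finite_vectorspace_tr)
  have fin: "finite S" "S \<subseteq> pos_roots n"
    using S finite_subset finite_pos_roots by (auto simp: up_closed_def)
  let ?d = "vectorspace.dim class_ring (vs D)"
  have cD: "card D = CARD('k) ^ ?d" using card_submodule[OF D] by simp
  have "card (ideal_of n S D) = CARD('k) ^ (?d + card S)"
    using card_ideal_of[OF S D DT] cD by (simp add: power_add)
  then have 1: "vectorspace.dim class_ring (vs (ideal_of n S D)) = ?d + card S"
    using dim_submodule_eq_iff[OF submodule_ideal_of[OF S D DT]] by simp
  \<comment> \<open>Bounds the dimension of \<open>D\<close>, so that the subtraction in the last
    summand does not truncate.\<close>
  have "card D \<le> card (torus n S :: 'k mat set)"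
    by (rule card_mono[OF finite_submodule[OF submodule_torus] DT])
  then have "?d \<le> n - card (broken n S)"
    using power_le_imp_le_exp[OF q_gt_1] by (simp add: cD card_torus[OF S])
  moreover have "card (pos_roots n - S) = card (pos_roots n) - card S" "card S \<le> card (pos_roots n)"
    using card_Diff_subset[OF fin] card_mono[OF finite_pos_roots fin(2)] by simp_all
  ultimately show ?thesis
    using card_broken_le[of n S] by (simp add: codim_def 1 dim_tr)
qed

text \<open>The zeta function sums \<open>t\<close> to the codimension over all ideals. Indexing
  ideals by pairs \<open>(S, D)\<close> lets the inner sum over \<open>D\<close> run through all
  subspaces of the torus of \<open>S\<close>.\<close>

lemma ideal_zeta_tr:
  fixes s :: complex
  defines "t \<equiv> of_nat CARD('k::{field,finite}) powr (- s)"
  shows "ideal_zeta (tr TYPE('k) n) s =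
    (\<Sum>S | up_closed n S. t ^ (card (pos_roots n - S) + card (broken n S)) *
       gauss_zeta CARD('k) (n - card (broken n S)) t)"
proof -
  interpret finite_vectorspace "class_ring :: 'k ring" "tr TYPE('k) n"
    by (rule finite_vectorspace_tr)
  let ?I = "{I. lie_ideal class_ring I (tr TYPE('k) n)}"
  let ?c = "\<lambda>I. codim class_ring I (tr TYPE('k) n)"
  let ?U = "{S. up_closed n S}"
  let ?D = "\<lambda>S. {D. submodule class_ring D (tr TYPE('k) n) \<and> D \<subseteq> torus n S}"
  have "?I \<subseteq> {W. submodule class_ring W (tr TYPE('k) n) \<and> True}" by (auto simp: lie_ideal_def)
  then have finI: "finite ?I" by (rule finite_subset) (rule finite_submodules)
  have "?U \<subseteq> Pow (pos_roots n)" by (auto simp: up_closed_def)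
  then have finU: "finite ?U" by (rule finite_subset) (simp add: finite_pos_roots)
  have "ideal_zeta (tr TYPE('k) n) s = (\<Sum>i\<le>dim. \<Sum>I | I \<in> ?I \<and> ?c I = i. t ^ ?c I)"
    by (simp add: ideal_zeta_def num_ideals_def t_def)
  also have "\<dots> = (\<Sum>I\<in>?I. t ^ ?c I)"
    by (rule sum.group) (use finI in \<open>auto simp: codim_def\<close>)
  \<comment> \<open>\<open>ideal_of\<close> and the pair \<open>roots_of\<close>,
    \<open>torus_of\<close> are mutually inverse between ideals and admissible pairs.\<close>
  also have "\<dots> = (\<Sum>(S, D)\<in>Sigma ?U ?D. t ^ ?c (ideal_of n S D))"
    by (rule sum.reindex_bij_witness[where i = "\<lambda>(S, D). ideal_of n S D"
          and j = "\<lambda>I. (roots_of n I, torus_of I)"])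
      (auto simp: up_closed_roots_of submodule_torus_of ideal_of_roots_of lie_ideal_ideal_of
        roots_of_ideal_of torus_of_ideal_of dest: subsetD[OF torus_of_subset])
  also have "\<dots> = (\<Sum>S\<in>?U. \<Sum>D\<in>?D S. t ^ ?c (ideal_of n S D))"
    by (rule sum.Sigma[symmetric]) (simp_all add: finU finite_submodules)
  also have "\<dots> = (\<Sum>S\<in>?U. t ^ (card (pos_roots n - S) + card (broken n S)) *
       gauss_zeta CARD('k) (n - card (broken n S)) t)"
  proof (rule sum.cong[OF refl])
    fix S assume "S \<in> ?U"
    then have S: "up_closed n S" by simp
    have "(\<Sum>D\<in>?D S. t ^ ?c (ideal_of n S D)) =
        (\<Sum>D\<in>?D S. t ^ (card (pos_roots n - S) + card (broken n S)) *
          t ^ (n - card (broken n S) - vectorspace.dim class_ring (vs D)))"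
      by (rule sum.cong[OF refl]) (simp add: codim_ideal_of[OF S] power_add)
    also have "\<dots> = t ^ (card (pos_roots n - S) + card (broken n S)) *
        gauss_zeta CARD('k) (n - card (broken n S)) t"
    proof -
      have "card (torus n S :: 'k mat set) = q ^ (n - card (broken n S))"
        by (simp add: card_torus[OF S])
      from sum_submodules_codim[OF submodule_torus this, of t]
      have "(\<Sum>D\<in>?D S. t ^ (n - card (broken n S) - vectorspace.dim class_ring (vs D))) =
          gauss_zeta CARD('k) (n - card (broken n S)) t" by simp
      then show ?thesis by (simp only: sum_distrib_left[symmetric])
    qed
    finally show "(\<Sum>D\<in>?D S. t ^ ?c (ideal_of n S D)) = \<dots>" .
  qed
  finally show ?thesis .
qed

section \<open>Explicit evaluation for small n\<close>

text \<open>Subsets are split by whether they contain \<open>a\<close>. As a rewrite rule this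
  expands a sum over the power set of an explicit set into single terms.\<close>

lemma sum_Pow_insert:
  assumes "finite A" "a \<notin> A"
  shows "(\<Sum>S\<in>Pow (insert a A). f S) = (\<Sum>S\<in>Pow A. f S) + (\<Sum>S\<in>Pow A. f (insert a S))"
proof -
  have "inj_on (insert a) (Pow A)" using assms(2) by (intro inj_onI) (metis PowD insert_ident subsetD)
  moreover have "Pow A \<inter> insert a ` Pow A = {}" using assms(2) by auto
  ultimately show ?thesis
    using assms(1) by (simp add: Pow_insert sum.union_disjoint sum.reindex)
qed

text \<open>Up-closure becomes a test on each subset of the explicit root set, which rewriting can
  decide term by term.\<close>

lemma sum_up_closed:
  "(\<Sum>S | up_closed n S. f S) = (\<Sum>S\<in>Pow (pos_roots n).
     if \<forall>(i, j)\<in>pos_roots n. \<forall>(k, l)\<in>pos_roots n. k \<le> i \<and> j \<le> l \<longrightarrow> (i, j) \<in> S \<longrightarrow> (k, l) \<in> S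
     then f S else 0)"
proof -
  have "{S. up_closed n S} = {S \<in> Pow (pos_roots n).
      \<forall>(i, j)\<in>pos_roots n. \<forall>(k, l)\<in>pos_roots n. k \<le> i \<and> j \<le> l \<longrightarrow> (i, j) \<in> S \<longrightarrow> (k, l) \<in> S}"
    unfolding up_closed_def by blast
  then show ?thesis by (simp only: sum.inter_filter finite_Pow_iff finite_pos_roots)
qed

lemma card_pos_roots_Diff: "card (pos_roots n - S) = (\<Sum>p\<in>pos_roots n. if p \<in> S then 0 else 1)"
proof -
  have "(\<Sum>p\<in>pos_roots n. if p \<in> S then 0 else 1) = (\<Sum>p\<in>pos_roots n - S. 1 :: nat)"
    by (rule sum.mono_neutral_cong_right) (auto simp: finite_pos_roots)
  then show ?thesis by simp
qed

lemma card_broken: "card (broken n S) = (\<Sum>k<n - 1. if (k, Suc k) \<in> S then 0 else 1)"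
proof -
  have "(\<Sum>k<n - 1. if (k, Suc k) \<in> S then 0 else 1) = (\<Sum>k\<in>broken n S. 1 :: nat)"
    by (rule sum.mono_neutral_cong_right) (auto simp: broken_def)
  then show ?thesis by simp
qed

lemma gauss_zeta_small:
  "gauss_zeta q 1 t = 1 + t"
  "gauss_zeta q 2 t = 1 + (1 + of_nat q) * t + t^2"
  "gauss_zeta q 3 t = 1 + (1 + of_nat q + of_nat q^2) * (t + t^2) + t^3"
  "gauss_zeta q 4 t = 1 + (1 + of_nat q + of_nat q^2 + of_nat q^3) * (t + t^3) +
     (1 + of_nat q + 2 * of_nat q^2 + of_nat q^3 + of_nat q^4) * t^2 + t^4"
  for t :: "'a::comm_ring_1"
  by (simp_all add: gauss_zeta_def eval_nat_numeral algebra_simps)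

text \<open>The coefficient sequences are palindromic, so the exponents \<open>i\<close> and
  \<open>m - i\<close> give the same sum; for these \<open>m\<close> both sides are expanded and
  compared.\<close>

lemma space_zeta_small:
  fixes s defines "t \<equiv> of_nat CARD('k::{field,finite}) powr (- s)"
  shows "space_zeta TYPE('k) 1 s = gauss_zeta CARD('k) 1 t"
    "space_zeta TYPE('k) 2 s = gauss_zeta CARD('k) 2 t"
    "space_zeta TYPE('k) 3 s = gauss_zeta CARD('k) 3 t"
    "space_zeta TYPE('k) 4 s = gauss_zeta CARD('k) 4 t"
  unfolding space_zeta_eq t_def[symmetric]
  by (simp_all add: gauss_zeta_def eval_nat_numeral algebra_simps)

lemma pos_roots_small:
  "pos_roots 1 = {}" "pos_roots 2 = {(0, 1)}" "pos_roots 3 = {(0, 1), (0, 2), (1, 2)}"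
  "pos_roots 4 = {(0, 1), (0, 2), (0, 3), (1, 2), (1, 3), (2, 3)}"
  by (auto simp: pos_roots_def less_Suc_eq numeral_eq_Suc)

text \<open>The upper sets are enumerated. For \<open>n = 4\<close>, losing only simple roots gives
  the terms up to \<open>t^6 * Z 1\<close>; the doubled bracket comes from losing exactly one root
  of height two as well, with two or all three simple roots missing; \<open>t^8\<close> belongs to
  the highest root alone and \<open>t^9\<close> to the empty set.\<close>

lemma ideal_zeta_tr_small:
  fixes s :: complex
  defines "t \<equiv> of_nat CARD('k::{field,finite}) powr (- s)"
  defines "Z \<equiv> \<lambda>m. gauss_zeta CARD('k) m t"
  shows "ideal_zeta (tr TYPE('k) 1) s = Z 1"
    and "ideal_zeta (tr TYPE('k) 2) s = Z 2 + t^2 * Z 1"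
    and "ideal_zeta (tr TYPE('k) 3) s = Z 3 + 2 * t^2 * Z 2 + t^4 * Z 1 + t^5 * Z 1"
    and "ideal_zeta (tr TYPE('k) 4) s = Z 4 + 3 * t^2 * Z 3 + 3 * t^4 * Z 2 + t^6 * Z 1
      + 2 * t^5 * (Z 2 + t^2 * Z 1) + t^8 * Z 1 + t^9 * Z 1"
proof -
  let ?b = "\<lambda>n S. \<Sum>k<n - 1. if (k, Suc k) \<in> S then 0 else 1 :: nat"
  have *: "ideal_zeta (tr TYPE('k) n) s = (\<Sum>S\<in>Pow (pos_roots n).
      if \<forall>(i, j)\<in>pos_roots n. \<forall>(k, l)\<in>pos_roots n. k \<le> i \<and> j \<le> l \<longrightarrow> (i, j) \<in> S \<longrightarrow> (k, l) \<in> S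
      then t ^ ((\<Sum>p\<in>pos_roots n. if p \<in> S then 0 else 1) + ?b n S) * Z (n - ?b n S) else 0)" for n
    unfolding ideal_zeta_tr sum_up_closed card_pos_roots_Diff card_broken
    by (simp only: t_def Z_def)
  show "ideal_zeta (tr TYPE('k) 1) s = Z 1"
    unfolding * pos_roots_small by simp
  show "ideal_zeta (tr TYPE('k) 2) s = Z 2 + t^2 * Z 1"
    unfolding * pos_roots_small by (simp add: sum_Pow_insert power2_eq_square)
  show "ideal_zeta (tr TYPE('k) 3) s = Z 3 + 2 * t^2 * Z 2 + t^4 * Z 1 + t^5 * Z 1"
    unfolding * pos_roots_small
    by (simp add: sum_Pow_insert lessThan_nat_numeral) (simp add: eval_nat_numeral algebra_simps)
  show "ideal_zeta (tr TYPE('k) 4) s = Z 4 + 3 * t^2 * Z 3 + 3 * t^4 * Z 2 + t^6 * Z 1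
      + 2 * t^5 * (Z 2 + t^2 * Z 1) + t^8 * Z 1 + t^9 * Z 1"
    unfolding * pos_roots_small
    by (simp add: sum_Pow_insert lessThan_nat_numeral) (simp add: eval_nat_numeral algebra_simps)
qed

theorem theorem5p6:
  fixes p :: nat and s t :: complex
  assumes "prime p" and "CARD('p::prime_card) = p"
    and "t = of_nat p powr (- s)"
  shows
    "(ideal_zeta (tr TYPE('p mod_ring) 1) s
        = space_zeta TYPE('p mod_ring) 1 s
    \<and> ideal_zeta (tr TYPE('p mod_ring) 1) s
        = 1 + t)
   \<and> (ideal_zeta (tr TYPE('p mod_ring) 2) s
        = space_zeta TYPE('p mod_ring) 2 s + t^2 * space_zeta TYPE('p mod_ring) 1 s
    \<and> ideal_zeta (tr TYPE('p mod_ring) 2) s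
        = 1 + (1 + of_nat p) * t + 2 * t^2 + t^3)
   \<and> (ideal_zeta (tr TYPE('p mod_ring) 3) s
        = space_zeta TYPE('p mod_ring) 3 s + 2 * t^2 * space_zeta TYPE('p mod_ring) 2 s
          + t^4 * space_zeta TYPE('p mod_ring) 1 s + t^5 * space_zeta TYPE('p mod_ring) 1 s
    \<and> ideal_zeta (tr TYPE('p mod_ring) 3) s
        = 1 + (1 + of_nat p + of_nat p^2) * t + (3 + of_nat p + of_nat p^2) * t^2
          + (3 + 2 * of_nat p) * t^3 + 3 * t^4 + 2 * t^5 + t^6)
   \<and> (ideal_zeta (tr TYPE('p mod_ring) 4) s
        = space_zeta TYPE('p mod_ring) 4 s + 3 * t^2 * space_zeta TYPE('p mod_ring) 3 s
          + 3 * t^4 * space_zeta TYPE('p mod_ring) 2 s + t^6 * space_zeta TYPE('p mod_ring) 1 s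
          + 2 * t^5 * (space_zeta TYPE('p mod_ring) 2 s + t^2 * space_zeta TYPE('p mod_ring) 1 s)
          + t^8 * space_zeta TYPE('p mod_ring) 1 s + t^9 * space_zeta TYPE('p mod_ring) 1 s
    \<and> ideal_zeta (tr TYPE('p mod_ring) 4) s
        = 1 + (1 + of_nat p + of_nat p^2 + of_nat p^3) * t
          + (4 + of_nat p + 2 * of_nat p^2 + of_nat p^3 + of_nat p^4) * t^2
          + (4 + 4 * of_nat p + 4 * of_nat p^2 + of_nat p^3) * t^3
          + (7 + 3 * of_nat p + 3 * of_nat p^2) * t^4 + (8 + 3 * of_nat p) * t^5
          + (6 + 2 * of_nat p) * t^6 + 5 * t^7 + 3 * t^8 + 2 * t^9 + t^10)"
proof -
  have card: "CARD('p mod_ring) = p" using assms(2) by simp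
  note zeta = ideal_zeta_tr_small[where ?'k = "'p mod_ring", of s, unfolded card assms(3)[symmetric]]
    and space = space_zeta_small[where ?'k = "'p mod_ring", of s, unfolded card assms(3)[symmetric]]
  show ?thesis
    \<comment> \<open>All zeta functions are now polynomials in \<open>t\<close> and
      \<open>p\<close>, and what remains are polynomial identities.\<close>
    unfolding zeta space gauss_zeta_small
    by (intro conjI refl) (simp_all add: eval_nat_numeral algebra_simps)
qed

end
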